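(* Let $(M,F)$ be an AR-Finsler manifold, with $g_{ij}=\eta\,a_{ij}$. Then the geodesic spray coefficients $G^i(x,y)$ of $F$ are (all) rational functions in $y$ if and only if the functions $\partial_k\log(\eta(x,y))$ are (all) rational functions in $y$.
   Context: $M$ is a smooth $n$-dimensional manifold with local coordinates $(x^i)$ and induced fibre coordinates $(y^i)$ on $TM$; $\partial_i=\partial/\partial x^i$, $\dot{\partial}_i=\partial/\partial y^i$; the summation convention is used. A Finsler metric on $M$ is a map $F:TM\to[0,\infty)$ which is $C^\infty$ on $TM\setminus\{0\}$, positively homogeneous of degree one in $y$, and such that $g_{ij}(x,y):=\frac12\dot{\partial}_i\dot{\partial}_jF^2$ is positive definite at each point of $TM\setminus\{0\}$; $(g^{ij})$ is the inverse matrix. "Rational in $y$" means: locally in $x$, a quotient of two polynomials in $y$ whose coefficients are smooth functions of $x$. $F$ is an AR-Finsler metric (and $(M,F)$ an AR-Finsler manifold) if $g_{ij}(x,y)=\eta(x,y)\,a_{ij}(x,y)$ where (a) $\eta:TM\setminus\{0\}\to[0,\infty)$ is smooth; (b) $(a_{ij}(x,y))$ is a symmetric positive definite matrix with each $a_{ij}$ rational in $y$; (c) each product $\eta\,a_{ij}$ is positively homogeneous of degree zero in $y$. Such a decomposition is fixed. The spray coefficients are $G^i=\frac14 g^{ir}\left(y^k\dot{\partial}_r\partial_kF^2-\partial_rF^2\right)$. *)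

theory Defs
  imports "HOL-Analysis.Analysis"
begin

section \<open>Smooth maps between open subsets of normed spaces\<close>

text \<open>The set \<open>S\<close> is meant to be open.\<close>

primrec Ck_on :: "nat \<Rightarrow> 'a::real_normed_vector set \<Rightarrow> ('a \<Rightarrow> 'b::real_normed_vector) \<Rightarrow> bool" where
  "Ck_on 0 S f \<longleftrightarrow> continuous_on S f"
| "Ck_on (Suc k) S f \<longleftrightarrow>
     (\<forall>x\<in>S. f differentiable (at x)) \<and> (\<forall>v. Ck_on k S (\<lambda>x. frechet_derivative f (at x) v))"

definition smooth_on :: "'a::real_normed_vector set \<Rightarrow> ('a \<Rightarrow> 'b::real_normed_vector) \<Rightarrow> bool" where
  "smooth_on S f \<longleftrightarrow> (\<forall>k. Ck_on k S f)"


section \<open>Smooth manifolds\<close>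

text \<open>A chart is a pair of a domain and a coordinate map; the values of the coordinate map
  outside the domain are irrelevant. The dimension is \<open>n = CARD('n)\<close>.\<close>

type_synonym ('m, 'n) chart = "'m set \<times> ('m \<Rightarrow> real ^ 'n)"

definition is_chart :: "'m topology \<Rightarrow> ('m, 'n::finite) chart \<Rightarrow> bool" where
  "is_chart M c \<longleftrightarrow> openin M (fst c) \<and> open (snd c ` fst c) \<and>
     homeomorphic_map (subtopology M (fst c)) (top_of_set (snd c ` fst c)) (snd c)"

definition transition :: "('m, 'n::finite) chart \<Rightarrow> ('m, 'n) chart \<Rightarrow> real ^ 'n \<Rightarrow> real ^ 'n" where
  "transition c d = snd d \<circ> inv_into (fst c) (snd c)"

definition smoothly_compatible :: "('m, 'n::finite) chart \<Rightarrow> ('m, 'n) chart \<Rightarrow> bool" where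
  "smoothly_compatible c d \<longleftrightarrow>
     smooth_on (snd c ` (fst c \<inter> fst d)) (transition c d) \<and>
     smooth_on (snd d ` (fst c \<inter> fst d)) (transition d c)"

text \<open>The smooth structure is given by its maximal atlas, so the members of \<open>A\<close> are exactly
  the local coordinate systems of the manifold.\<close>

definition smooth_manifold :: "'m topology \<Rightarrow> ('m, 'n::finite) chart set \<Rightarrow> bool" where
  "smooth_manifold M A \<longleftrightarrow>
     Hausdorff_space M \<and> second_countable M \<and>
     (\<forall>c\<in>A. is_chart M c) \<and> (\<Union>c\<in>A. fst c) = topspace M \<and>
     (\<forall>c\<in>A. \<forall>d\<in>A. smoothly_compatible c d) \<and>
     (\<forall>c. is_chart M c \<and> (\<forall>d\<in>A. smoothly_compatible c d) \<longrightarrow> c \<in> A)"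


section \<open>The tangent bundle\<close>

text \<open>A tangent vector at \<open>p\<close> is the family of its components in all the charts around \<open>p\<close>,
  related by the Jacobians of the coordinate changes. Components in charts not containing \<open>p\<close>
  are set to 0, so that equality of families is equality of tangent vectors.\<close>

type_synonym ('m, 'n) tvec = "('m, 'n) chart \<Rightarrow> real ^ 'n"

definition tangent_space :: "('m, 'n::finite) chart set \<Rightarrow> 'm \<Rightarrow> ('m, 'n) tvec set" where
  "tangent_space A p = {v.
     (\<forall>c\<in>A. \<forall>d\<in>A. p \<in> fst c \<inter> fst d \<longrightarrow>
        v d = frechet_derivative (transition c d) (at (snd c p)) (v c)) \<and>
     (\<forall>c. \<not> (c \<in> A \<and> p \<in> fst c) \<longrightarrow> v c = 0)}"

definition tangent_bundle :: "'m topology \<Rightarrow> ('m, 'n::finite) chart set \<Rightarrow> ('m \<times> ('m, 'n) tvec) set" where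
  "tangent_bundle M A = (SIGMA p:topspace M. tangent_space A p)"

definition slit_tangent_bundle :: "'m topology \<Rightarrow> ('m, 'n::finite) chart set \<Rightarrow> ('m \<times> ('m, 'n) tvec) set" where
  "slit_tangent_bundle M A = {(p, v) \<in> tangent_bundle M A. v \<noteq> (\<lambda>_. 0)}"

text \<open>The induced coordinates \<open>(x, y)\<close> on the part of the tangent bundle over a chart domain,
  and the expression of a function on the (slit) tangent bundle in these coordinates.\<close>

definition induced_coords :: "('m, 'n::finite) chart \<Rightarrow> 'm \<times> ('m, 'n) tvec \<Rightarrow> (real ^ 'n) \<times> (real ^ 'n)" where
  "induced_coords c = (\<lambda>(p, v). (snd c p, v c))"

definition local_expr :: "('m, 'n::finite) chart set \<Rightarrow> ('m, 'n) chart \<Rightarrow> ('m \<times> ('m, 'n) tvec \<Rightarrow> 'b)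
    \<Rightarrow> (real ^ 'n) \<times> (real ^ 'n) \<Rightarrow> 'b" where
  "local_expr A c f = f \<circ> inv_into (SIGMA p:fst c. tangent_space A p) (induced_coords c)"

definition smooth_on_slit :: "('m, 'n::finite) chart set \<Rightarrow> ('m \<times> ('m, 'n) tvec \<Rightarrow> real) \<Rightarrow> bool" where
  "smooth_on_slit A f \<longleftrightarrow>
     (\<forall>c\<in>A. smooth_on ((snd c ` fst c) \<times> (UNIV - {0})) (local_expr A c f))"


section \<open>Finsler metrics and their sprays in coordinates\<close>

definition dx :: "'n::finite \<Rightarrow> ((real ^ 'n) \<times> (real ^ 'n) \<Rightarrow> real) \<Rightarrow> (real ^ 'n) \<times> (real ^ 'n) \<Rightarrow> real" where
  "dx i f z = frechet_derivative f (at z) (axis i 1, 0)"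

definition dy :: "'n::finite \<Rightarrow> ((real ^ 'n) \<times> (real ^ 'n) \<Rightarrow> real) \<Rightarrow> (real ^ 'n) \<times> (real ^ 'n) \<Rightarrow> real" where
  "dy i f z = frechet_derivative f (at z) (0, axis i 1)"

definition pos_definite :: "real ^ 'n ^ 'n \<Rightarrow> bool" where
  "pos_definite B \<longleftrightarrow> (\<forall>u. u \<noteq> 0 \<longrightarrow> u \<bullet> (B *v u) > 0)"

text \<open>The next two definitions take the local expression of \<open>F\<close>.\<close>

definition fundamental_tensor :: "((real ^ 'n::finite) \<times> (real ^ 'n) \<Rightarrow> real) \<Rightarrow> (real ^ 'n) \<times> (real ^ 'n)
    \<Rightarrow> real ^ 'n ^ 'n" where
  "fundamental_tensor F z = (\<chi> i j. 1/2 * dy i (dy j (\<lambda>w. (F w)\<^sup>2)) z)"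

definition spray_coeff :: "((real ^ 'n::finite) \<times> (real ^ 'n) \<Rightarrow> real) \<Rightarrow> 'n
    \<Rightarrow> (real ^ 'n) \<times> (real ^ 'n) \<Rightarrow> real" where
  "spray_coeff F i z =
     1/4 * (\<Sum>r\<in>UNIV. matrix_inv (fundamental_tensor F z) $ i $ r *
              ((\<Sum>k\<in>UNIV. snd z $ k * dy r (dx k (\<lambda>w. (F w)\<^sup>2)) z) - dx r (\<lambda>w. (F w)\<^sup>2) z))"

definition finsler_metric :: "'m topology \<Rightarrow> ('m, 'n::finite) chart set \<Rightarrow> ('m \<times> ('m, 'n) tvec \<Rightarrow> real) \<Rightarrow> bool" where
  "finsler_metric M A F \<longleftrightarrow>
     (\<forall>w\<in>tangent_bundle M A. 0 \<le> F w) \<and>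
     smooth_on_slit A F \<and>
     (\<forall>(p, v)\<in>tangent_bundle M A. \<forall>t>0. F (p, \<lambda>c. t *\<^sub>R v c) = t * F (p, v)) \<and>
     (\<forall>c\<in>A. \<forall>x\<in>snd c ` fst c. \<forall>y. y \<noteq> 0 \<longrightarrow>
        pos_definite (fundamental_tensor (local_expr A c F) (x, y)))"


section \<open>Rationality in the fibre coordinates\<close>

text \<open>Polynomials in \<open>y\<close> with coefficients smooth on \<open>V\<close>; \<open>N\<close> is a finite set of multi-indices.\<close>

definition smooth_polynomial :: "(real ^ 'n::finite) set \<Rightarrow> (real ^ 'n \<Rightarrow> real ^ 'n \<Rightarrow> real) \<Rightarrow> bool" where
  "smooth_polynomial V P \<longleftrightarrow>
     (\<exists>(N :: ('n \<Rightarrow> nat) set) C. finite N \<and> (\<forall>\<alpha>\<in>N. smooth_on V (C \<alpha>)) \<and>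
        (\<forall>x\<in>V. \<forall>y. P x y = (\<Sum>\<alpha>\<in>N. C \<alpha> x * (\<Prod>i\<in>UNIV. (y $ i) ^ \<alpha> i))))"

text \<open>Rationality of a function on \<open>X \<times> (\<real>\<^sup>n - 0)\<close>, \<open>X\<close> open. The quotient has to represent the
  function at every point of its domain, so the denominator must not vanish there.\<close>

definition rational_in_y :: "(real ^ 'n::finite) set \<Rightarrow> ((real ^ 'n) \<times> (real ^ 'n) \<Rightarrow> real) \<Rightarrow> bool" where
  "rational_in_y X f \<longleftrightarrow>
     (\<forall>x0\<in>X. \<exists>V P Q. open V \<and> x0 \<in> V \<and> V \<subseteq> X \<and> smooth_polynomial V P \<and> smooth_polynomial V Q \<and>
        (\<forall>x\<in>V. \<forall>y. y \<noteq> 0 \<longrightarrow> Q x y \<noteq> 0 \<and> f (x, y) = P x y / Q x y))"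


section \<open>AR-Finsler metrics\<close>

text \<open>\<open>F\<close> is an AR-Finsler metric with the fixed decomposition \<open>g\<^sub>i\<^sub>j = \<eta> a\<^sub>i\<^sub>j\<close>; here \<open>\<eta>\<close> is a function on
  the slit tangent bundle and \<open>a c (x, y)\<close> is the matrix \<open>(a\<^sub>i\<^sub>j(x, y))\<close> in the chart \<open>c\<close>.\<close>

definition AR_finsler :: "'m topology \<Rightarrow> ('m, 'n::finite) chart set \<Rightarrow> ('m \<times> ('m, 'n) tvec \<Rightarrow> real)
    \<Rightarrow> ('m \<times> ('m, 'n) tvec \<Rightarrow> real) \<Rightarrow> (('m, 'n) chart \<Rightarrow> (real ^ 'n) \<times> (real ^ 'n) \<Rightarrow> real ^ 'n ^ 'n) \<Rightarrow> bool" where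
  "AR_finsler M A F \<eta> a \<longleftrightarrow>
     finsler_metric M A F \<and>
     (\<forall>w\<in>slit_tangent_bundle M A. 0 \<le> \<eta> w) \<and> smooth_on_slit A \<eta> \<and>
     (\<forall>c\<in>A.
        (\<forall>i j. rational_in_y (snd c ` fst c) (\<lambda>z. a c z $ i $ j)) \<and>
        (\<forall>x\<in>snd c ` fst c. \<forall>y. y \<noteq> 0 \<longrightarrow>
           transpose (a c (x, y)) = a c (x, y) \<and> pos_definite (a c (x, y)) \<and>
           (\<forall>i j. fundamental_tensor (local_expr A c F) (x, y) $ i $ j
                    = local_expr A c \<eta> (x, y) * a c (x, y) $ i $ j) \<and>
           (\<forall>i j. \<forall>t>0. local_expr A c \<eta> (x, t *\<^sub>R y) * a c (x, t *\<^sub>R y) $ i $ j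
                    = local_expr A c \<eta> (x, y) * a c (x, y) $ i $ j)))"

end

theory Submission
  imports Defs
begin

text \<open>
  Write \<open>E = F\<^sup>2\<close>, \<open>b\<^sub>r = a\<^sub>r\<^sub>j y\<^sup>j\<close> and \<open>Q = b\<^sub>r y\<^sup>r > 0\<close>. By Euler's theorem \<open>E = \<eta> Q\<close> and
  \<open>\<partial>E/\<partial>y\<^sup>r = 2 \<eta> b\<^sub>r\<close>, so no fibre derivative of \<open>\<eta>\<close> survives in the spray: after interchanging
  \<open>x\<close>- and \<open>y\<close>-derivatives, \<open>\<eta>\<close> cancels from the defining equation, which becomes
  \<open>4 a\<^sub>r\<^sub>i G\<^sup>i = 2 s b\<^sub>r - L\<^sub>r Q + H\<^sub>r\<close> with \<open>L\<^sub>k = \<partial>\<^sub>k log \<eta>\<close>, \<open>s = y\<^sup>k L\<^sub>k\<close> and \<open>H\<^sub>r\<close> rational in \<open>y\<close>.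
  If the \<open>L\<^sub>k\<close> are rational, Cramer's rule makes the \<open>G\<^sup>i\<close> rational. Conversely, contraction
  with \<open>y\<^sup>r\<close> gives \<open>s Q\<close> as a rational function, and then the equation is solved for \<open>L\<^sub>r\<close>.
\<close>

section \<open>Smooth functions\<close>

lemma frechet_derivative_eq:
  assumes "(f has_derivative f') (at x)"
  shows "frechet_derivative f (at x) = f'"
  using frechet_derivative_at[OF assms] by simp

lemma Ck_on_subset: "Ck_on k S f \<Longrightarrow> T \<subseteq> S \<Longrightarrow> Ck_on k T f"
proof (induction k arbitrary: f)
  case 0
  then show ?case by (auto intro: continuous_on_subset)
next
  case (Suc k)
  then show ?case by auto
qed

text \<open>Since \<open>S\<close> is open, agreement on \<open>S\<close> is agreement near each of
  its points, so the derivatives \<open>at x\<close> agree as well and the induction can pass to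
  them.\<close>

lemma Ck_on_cong:
  assumes "open S" "\<And>x. x \<in> S \<Longrightarrow> f x = g x" "Ck_on k S f"
  shows "Ck_on k S g"
  using assms(2,3)
proof (induction k arbitrary: f g)
  case 0
  then show ?case using continuous_on_cong[of S S f g] by simp
next
  case (Suc k)
  have d: "(g has_derivative frechet_derivative f (at x)) (at x)" if "x \<in> S" for x
  proof (rule has_derivative_transform_within_open[OF _ assms(1) that])
    show "(f has_derivative frechet_derivative f (at x)) (at x)"
      using Suc.prems(2) that by (simp add: frechet_derivative_works)
  qed (use Suc.prems(1) in auto)
  have "Ck_on k S (\<lambda>x. frechet_derivative g (at x) v)" for v
  proof (rule Suc.IH)
    show "Ck_on k S (\<lambda>x. frechet_derivative f (at x) v)"
      using Suc.prems(2) by simp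
  qed (simp add: frechet_derivative_eq[OF d])
  with d show ?case by (auto simp: differentiable_def)
qed

text \<open>The recursion does not list the lower orders. At order 0 differentiability supplies
  continuity; higher up the claim passes to the directional derivatives.\<close>

lemma Ck_on_Suc_imp: "Ck_on (Suc k) S f \<Longrightarrow> Ck_on k S f"
proof (induction k arbitrary: f)
  case 0
  then show ?case
    by (auto intro!: continuous_at_imp_continuous_on differentiable_imp_continuous_within)
next
  case (Suc k)
  then show ?case by (metis Ck_on.simps(2))
qed

lemma Ck_on_const: "Ck_on k S (\<lambda>_. c)"
  by (induction k arbitrary: c) auto

lemma Ck_on_add:
  assumes "open S" "Ck_on k S f" "Ck_on k S g"
  shows "Ck_on k S (\<lambda>x. f x + g x)"
  using assms(2,3)
proof (induction k arbitrary: f g)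
  case 0
  then show ?case by (auto intro: continuous_intros)
next
  case (Suc k)
  have d: "((\<lambda>x. f x + g x) has_derivative
      (\<lambda>h. frechet_derivative f (at x) h + frechet_derivative g (at x) h)) (at x)" if "x \<in> S" for x
    using Suc.prems that by (intro has_derivative_add) (simp_all add: frechet_derivative_works)
  have "Ck_on k S (\<lambda>x. frechet_derivative (\<lambda>x. f x + g x) (at x) v)" for v
    by (rule Ck_on_cong[OF assms(1), where
          f = "\<lambda>x. frechet_derivative f (at x) v + frechet_derivative g (at x) v"])
      (use Suc in \<open>auto simp: frechet_derivative_eq[OF d]\<close>)
  with d show ?case by (auto simp: differentiable_def)
qed

lemma Ck_on_mult:
  fixes f g :: "'a::real_normed_vector \<Rightarrow> real"
  assumes "open S" "Ck_on k S f" "Ck_on k S g"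
  shows "Ck_on k S (\<lambda>x. f x * g x)"
  using assms(2,3)
proof (induction k arbitrary: f g)
  case 0
  then show ?case by (auto intro: continuous_intros)
next
  case (Suc k)
  have d: "((\<lambda>x. f x * g x) has_derivative
      (\<lambda>h. f x * frechet_derivative g (at x) h + frechet_derivative f (at x) h * g x)) (at x)"
    if "x \<in> S" for x
    using Suc.prems that by (intro has_derivative_mult) (simp_all add: frechet_derivative_works)
  \<comment> \<open>Each Leibniz term pairs a derivative of class \<open>k\<close> with an
    undifferentiated factor of class \<open>Suc k\<close>, which is lowered to \<open>k\<close>
    before the induction hypothesis applies.\<close>
  have "Ck_on k S (\<lambda>x. frechet_derivative (\<lambda>x. f x * g x) (at x) v)" for v
    by (rule Ck_on_cong[OF assms(1), where
          f = "\<lambda>x. f x * frechet_derivative g (at x) v + frechet_derivative f (at x) v * g x"])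
      (use Suc Suc.prems[THEN Ck_on_Suc_imp] in
        \<open>auto simp: frechet_derivative_eq[OF d] intro!: Ck_on_add[OF assms(1)]\<close>)
  with d show ?case by (auto simp: differentiable_def)
qed

lemma smooth_on_subset: "smooth_on S f \<Longrightarrow> T \<subseteq> S \<Longrightarrow> smooth_on T f"
  by (auto simp: smooth_on_def intro: Ck_on_subset)

lemma smooth_on_const: "smooth_on S (\<lambda>_. c)"
  by (simp add: smooth_on_def Ck_on_const)

lemma smooth_on_add: "open S \<Longrightarrow> smooth_on S f \<Longrightarrow> smooth_on S g \<Longrightarrow> smooth_on S (\<lambda>x. f x + g x)"
  by (simp add: smooth_on_def Ck_on_add)

lemma smooth_on_mult:
  fixes f g :: "'a::real_normed_vector \<Rightarrow> real"
  shows "open S \<Longrightarrow> smooth_on S f \<Longrightarrow> smooth_on S g \<Longrightarrow> smooth_on S (\<lambda>x. f x * g x)"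
  by (simp add: smooth_on_def Ck_on_mult)

lemma smooth_on_sum:
  "open S \<Longrightarrow> (\<And>i. i \<in> I \<Longrightarrow> smooth_on S (f i)) \<Longrightarrow> smooth_on S (\<lambda>x. \<Sum>i\<in>I. f i x)"
  by (induction I rule: infinite_finite_induct) (auto intro: smooth_on_const smooth_on_add)

lemma smooth_on_frechet_derivative: "smooth_on S f \<Longrightarrow> smooth_on S (\<lambda>x. frechet_derivative f (at x) v)"
  unfolding smooth_on_def by (metis Ck_on.simps(2))

lemma smooth_on_imp_differentiable: "smooth_on S f \<Longrightarrow> x \<in> S \<Longrightarrow> f differentiable (at x)"
  unfolding smooth_on_def by (metis Ck_on.simps(2))

lemma smooth_on_imp_continuous_on: "smooth_on S f \<Longrightarrow> continuous_on S f"
  unfolding smooth_on_def by (metis Ck_on.simps(1))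

section \<open>Symmetry of second derivatives\<close>

lemma frechet_derivative_mixed_difference:
  fixes f :: "'a::real_normed_vector \<Rightarrow> real"
  assumes f: "\<And>w. w \<in> S \<Longrightarrow> f differentiable (at w)"
    and fu: "\<And>w. w \<in> S \<Longrightarrow> (\<lambda>w. frechet_derivative f (at w) u) differentiable (at w)"
    and h: "0 < h"
    and box: "\<And>s t. 0 \<le> s \<Longrightarrow> s \<le> h \<Longrightarrow> 0 \<le> t \<Longrightarrow> t \<le> h \<Longrightarrow> z + s *\<^sub>R u + t *\<^sub>R v \<in> S"
  shows "\<exists>s t. 0 \<le> s \<and> s \<le> h \<and> 0 \<le> t \<and> t \<le> h \<and>
    f (z + h *\<^sub>R u + h *\<^sub>R v) - f (z + h *\<^sub>R u) - f (z + h *\<^sub>R v) + f z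
      = h * (h * frechet_derivative (\<lambda>w. frechet_derivative f (at w) u) (at (z + s *\<^sub>R u + t *\<^sub>R v)) v)"
proof -
  define fu where "fu = (\<lambda>w. frechet_derivative f (at w) u)"
  have D: "((\<lambda>s. g (p + s *\<^sub>R q)) has_real_derivative frechet_derivative g (at (p + s *\<^sub>R q)) q) (at s)"
    if "g differentiable (at (p + s *\<^sub>R q))" for g :: "'a \<Rightarrow> real" and p q s
  proof -
    have g: "(g has_derivative frechet_derivative g (at (p + s *\<^sub>R q))) (at (p + s *\<^sub>R q))"
      using that by (simp add: frechet_derivative_works)
    have "((\<lambda>s. p + s *\<^sub>R q) has_derivative (\<lambda>h. h *\<^sub>R q)) (at s)"
      by (auto intro!: derivative_eq_intros)
    from diff_chain_at[OF this g]
    show ?thesis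
      by (simp add: has_field_derivative_def o_def linear_cmul[OF has_derivative_linear[OF g]]
          mult_commute_abs)
  qed
  \<comment> \<open>The second difference over the parallelogram with sides \<open>h u\<close> and
    \<open>h v\<close> is the increment, along \<open>u\<close>, of the difference of
    \<open>f\<close> in direction \<open>v\<close>. The mean value theorem in \<open>s\<close> turns
    it into an increment of the \<open>u\<close>-derivative.\<close>
  have "\<exists>s>0. s < h \<and> (f (z + h *\<^sub>R v + h *\<^sub>R u) - f (z + h *\<^sub>R u)) - (f (z + h *\<^sub>R v + 0 *\<^sub>R u) - f (z + 0 *\<^sub>R u))
     = (h - 0) * (fu (z + h *\<^sub>R v + s *\<^sub>R u) - fu (z + s *\<^sub>R u))"
  proof (rule MVT2[OF h])
    fix s assume s: "0 \<le> s" "s \<le> h"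
    have "z + h *\<^sub>R v + s *\<^sub>R u \<in> S" "z + s *\<^sub>R u \<in> S"
      using box[of s h] box[of s 0] s h by (auto simp: algebra_simps)
    then show "((\<lambda>s. f (z + h *\<^sub>R v + s *\<^sub>R u) - f (z + s *\<^sub>R u)) has_real_derivative
        fu (z + h *\<^sub>R v + s *\<^sub>R u) - fu (z + s *\<^sub>R u)) (at s)"
      unfolding fu_def by (intro DERIV_diff D f)
  qed
  then obtain s where s: "0 < s" "s < h" and
    es: "f (z + h *\<^sub>R v + h *\<^sub>R u) - f (z + h *\<^sub>R u) - (f (z + h *\<^sub>R v) - f z)
     = h * (fu (z + h *\<^sub>R v + s *\<^sub>R u) - fu (z + s *\<^sub>R u))"
    by auto
  \<comment> \<open>A second mean value theorem, along \<open>v\<close> with \<open>s\<close> fixed,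
    produces the mixed derivative at a point of the parallelogram.\<close>
  have "\<exists>t>0. t < h \<and> fu (z + s *\<^sub>R u + h *\<^sub>R v) - fu (z + s *\<^sub>R u + 0 *\<^sub>R v)
     = (h - 0) * frechet_derivative fu (at (z + s *\<^sub>R u + t *\<^sub>R v)) v"
  proof (rule MVT2[OF h])
    fix t assume "0 \<le> t" "t \<le> h"
    then show "((\<lambda>t. fu (z + s *\<^sub>R u + t *\<^sub>R v)) has_real_derivative
        frechet_derivative fu (at (z + s *\<^sub>R u + t *\<^sub>R v)) v) (at t)"
      using box s unfolding fu_def by (intro D fu) auto
  qed
  then obtain t where t: "0 < t" "t < h" and
    et: "fu (z + s *\<^sub>R u + h *\<^sub>R v) - fu (z + s *\<^sub>R u)
      = h * frechet_derivative fu (at (z + s *\<^sub>R u + t *\<^sub>R v)) v"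
    by auto
  have "f (z + h *\<^sub>R u + h *\<^sub>R v) - f (z + h *\<^sub>R u) - f (z + h *\<^sub>R v) + f z
      = h * (h * frechet_derivative fu (at (z + s *\<^sub>R u + t *\<^sub>R v)) v)"
    using es et by (simp add: algebra_simps)
  with s t show ?thesis unfolding fu_def by (intro exI[of _ s] exI[of _ t]) auto
qed

text \<open>Schwarz's theorem. The second difference is symmetric in \<open>u\<close> and
  \<open>v\<close>, so divided by the square of \<open>h\<close> it is a value of either mixed
  derivative near \<open>z\<close>; continuity of both at \<open>z\<close> forces equality
  there.\<close>

lemma frechet_derivative_commute:
  fixes f :: "'a::real_normed_vector \<Rightarrow> real"
  assumes "open S" "z \<in> S" and f: "smooth_on S f"
  shows "frechet_derivative (\<lambda>w. frechet_derivative f (at w) u) (at z) v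
       = frechet_derivative (\<lambda>w. frechet_derivative f (at w) v) (at z) u"
proof (rule ccontr)
  define P where "P u v w = frechet_derivative (\<lambda>w. frechet_derivative f (at w) u) (at w) v" for u v w
  assume "\<not> ?thesis"
  then have ne: "P u v z \<noteq> P v u z" by (simp add: P_def)
  \<comment> \<open>Half the gap between the two mixed derivatives at \<open>z\<close>: no number
    lies within \<open>e\<close> of both.\<close>
  define e where "e = dist (P u v z) (P v u z) / 2"
  have e: "e > 0" using ne by (simp add: e_def)
  have "\<exists>d>0. \<forall>w. dist w z < d \<longrightarrow> w \<in> S \<and> dist (P a b w) (P a b z) < e" for a b
  proof -
    have "continuous_on S (P a b)"
      unfolding P_def by (intro smooth_on_imp_continuous_on smooth_on_frechet_derivative f)
    then have "isCont (P a b) z"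
      using assms(1,2) by (simp add: continuous_on_eq_continuous_at)
    then obtain d1 where "d1 > 0" "\<forall>w. dist w z < d1 \<longrightarrow> dist (P a b w) (P a b z) < e"
      using e unfolding continuous_at_eps_delta by blast
    moreover obtain d2 where "d2 > 0" "\<forall>w. dist w z < d2 \<longrightarrow> w \<in> S"
      using assms(1,2) unfolding open_dist by blast
    ultimately show ?thesis by (intro exI[of _ "min d1 d2"]) auto
  qed
  from this[of u v] this[of v u] obtain d1 d2 where "d1 > 0" "d2 > 0" and
    d1: "\<And>w. dist w z < d1 \<Longrightarrow> w \<in> S \<and> dist (P u v w) (P u v z) < e" and
    d2: "\<And>w. dist w z < d2 \<Longrightarrow> w \<in> S \<and> dist (P v u w) (P v u z) < e"
    by metis
  define d where "d = min d1 d2"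
  \<comment> \<open>With this side length the parallelogram stays within distance
    \<open>d / 2\<close> of \<open>z\<close>; the summand 1 keeps the denominator positive when
    \<open>u = v = 0\<close>.\<close>
  define h where "h = d / (2 * (norm u + norm v + 1))"
  have "d > 0" using \<open>d1 > 0\<close> \<open>d2 > 0\<close> by (simp add: d_def)
  have N: "norm u + norm v + 1 > 0" by (smt (verit) norm_ge_zero)
  have h: "h > 0" using \<open>d > 0\<close> N by (simp add: h_def)
  have near: "dist (z + s *\<^sub>R u + t *\<^sub>R v) z < d" if "0 \<le> s" "s \<le> h" "0 \<le> t" "t \<le> h" for s t
  proof -
    have "dist (z + s *\<^sub>R u + t *\<^sub>R v) z = norm (s *\<^sub>R u + t *\<^sub>R v)"
      by (simp add: dist_norm)
    also have "\<dots> \<le> s * norm u + t * norm v"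
      using norm_triangle_ineq[of "s *\<^sub>R u" "t *\<^sub>R v"] that by simp
    also have "\<dots> \<le> h * norm u + h * norm v"
      using that by (intro add_mono mult_right_mono) auto
    also have "\<dots> \<le> h * (norm u + norm v + 1)"
      using h by (simp add: algebra_simps)
    also have "\<dots> = d / 2" using N unfolding h_def by (simp add: field_simps del: distrib_left_numeral)
    finally show ?thesis using \<open>d > 0\<close> by simp
  qed
  have diff: "f differentiable (at w)" "(\<lambda>w. frechet_derivative f (at w) a) differentiable (at w)"
    if "w \<in> S" for w a
    using f that smooth_on_frechet_derivative smooth_on_imp_differentiable by blast+
  obtain s t where st: "0 \<le> s" "s \<le> h" "0 \<le> t" "t \<le> h" and
    1: "f (z + h *\<^sub>R u + h *\<^sub>R v) - f (z + h *\<^sub>R u) - f (z + h *\<^sub>R v) + f z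
      = h * (h * P u v (z + s *\<^sub>R u + t *\<^sub>R v))"
    using frechet_derivative_mixed_difference[OF diff(1) diff(2) h, of S z u v] near d1
    unfolding P_def d_def by auto
  \<comment> \<open>The same second difference, evaluated with the roles of \<open>u\<close> and
    \<open>v\<close> exchanged.\<close>
  obtain s' t' where st': "0 \<le> s'" "s' \<le> h" "0 \<le> t'" "t' \<le> h" and
    2: "f (z + h *\<^sub>R v + h *\<^sub>R u) - f (z + h *\<^sub>R v) - f (z + h *\<^sub>R u) + f z
      = h * (h * P v u (z + s' *\<^sub>R v + t' *\<^sub>R u))"
    using frechet_derivative_mixed_difference[OF diff(1) diff(2) h, of S z v u] near d1
    unfolding P_def d_def by (auto simp: add.assoc add.commute[of "_ *\<^sub>R v" "_ *\<^sub>R u"])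
  have "h * (h * P u v (z + s *\<^sub>R u + t *\<^sub>R v)) = h * (h * P v u (z + s' *\<^sub>R v + t' *\<^sub>R u))"
    using 1 2 by (simp add: algebra_simps)
  then have eq: "P u v (z + s *\<^sub>R u + t *\<^sub>R v) = P v u (z + s' *\<^sub>R v + t' *\<^sub>R u)"
    using h by simp
  have "dist (P u v (z + s *\<^sub>R u + t *\<^sub>R v)) (P u v z) < e"
    using d1 near[OF st] by (simp add: d_def)
  moreover have "dist (P v u (z + s' *\<^sub>R v + t' *\<^sub>R u)) (P v u z) < e"
    using d2 near[OF st'(3,4,1,2)] by (simp add: d_def algebra_simps)
  ultimately have "dist (P u v z) (P v u z) < e + e"
    unfolding eq by (metis dist_commute dist_triangle_less_add)
  then show False by (simp add: e_def)
qed

section \<open>Polynomials and rational functions in the fibre coordinates\<close>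

text \<open>Unlike in the definition, multi-indices may be repeated here.\<close>

lemma smooth_polynomialI:
  fixes V :: "(real ^ 'n::finite) set" and \<alpha> :: "'i \<Rightarrow> 'n \<Rightarrow> nat"
  assumes "open V" "finite I" "\<And>i. i \<in> I \<Longrightarrow> smooth_on V (C i)"
    and P: "\<And>x y. x \<in> V \<Longrightarrow> P x y = (\<Sum>i\<in>I. C i x * (\<Prod>j\<in>UNIV. (y $ j) ^ \<alpha> i j))"
  shows "smooth_polynomial V P"
  unfolding smooth_polynomial_def
\<comment> \<open>Terms with equal multi-index are merged: the coefficient at \<open>\<beta>\<close>
  is the sum over all indices that \<open>\<alpha>\<close> sends to \<open>\<beta>\<close>.\<close>
proof (intro exI[of _ "\<alpha> ` I"] exI[of _ "\<lambda>\<beta> x. \<Sum>i\<in>{i\<in>I. \<alpha> i = \<beta>}. C i x"] conjI ballI allI)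
  fix x y assume "x \<in> V"
  have "P x y = (\<Sum>\<beta>\<in>\<alpha> ` I. \<Sum>i\<in>{i\<in>I. \<alpha> i = \<beta>}. C i x * (\<Prod>j\<in>UNIV. (y $ j) ^ \<alpha> i j))"
    unfolding P[OF \<open>x \<in> V\<close>] by (rule sum.image_gen[OF assms(2)])
  also have "\<dots> = (\<Sum>\<beta>\<in>\<alpha> ` I. (\<Sum>i\<in>{i\<in>I. \<alpha> i = \<beta>}. C i x) * (\<Prod>j\<in>UNIV. (y $ j) ^ \<beta> j))"
    by (auto simp: sum_distrib_right intro!: sum.cong)
  finally show "P x y = \<dots>" .
qed (use assms in \<open>auto intro: smooth_on_sum\<close>)

lemma smooth_polynomial_subset:
  assumes "smooth_polynomial V P" "W \<subseteq> V"
  shows "smooth_polynomial W P"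
proof -
  from assms(1) obtain N C where "finite N" "\<forall>\<alpha>\<in>N. smooth_on V (C \<alpha>)"
    "\<forall>x\<in>V. \<forall>y. P x y = (\<Sum>\<alpha>\<in>N. C \<alpha> x * (\<Prod>i\<in>UNIV. (y $ i) ^ \<alpha> i))"
    unfolding smooth_polynomial_def by blast
  then show ?thesis
    unfolding smooth_polynomial_def using assms(2)
    by (intro exI[of _ N] exI[of _ C]) (auto intro: smooth_on_subset)
qed

lemma smooth_polynomial_const: "open V \<Longrightarrow> smooth_polynomial V (\<lambda>_ _. r)"
  by (rule smooth_polynomialI[where I = "{()}" and C = "\<lambda>_ _. r" and \<alpha> = "\<lambda>_ _. 0"])
    (auto intro: smooth_on_const)

lemma smooth_polynomial_component: "open V \<Longrightarrow> smooth_polynomial V (\<lambda>_ y. y $ k)"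
proof (rule smooth_polynomialI[where I = "{()}" and C = "\<lambda>_ _. 1" and
      \<alpha> = "\<lambda>_ j. if j = k then 1 else 0"])
  fix y :: "real ^ 'a"
  have "(\<Prod>j\<in>UNIV. (y $ j) ^ (if j = k then 1 else 0)) = (\<Prod>j\<in>UNIV. if j = k then y $ j else 1)"
    by (rule prod.cong) auto
  then show "y $ k = (\<Sum>i\<in>{()}. 1 * (\<Prod>j\<in>UNIV. (y $ j) ^ (if j = k then 1 else 0)))"
    by simp
qed (auto intro: smooth_on_const)

lemma smooth_polynomial_add:
  assumes "open V" "smooth_polynomial V P" "smooth_polynomial V Q"
  shows "smooth_polynomial V (\<lambda>x y. P x y + Q x y)"
proof -
  from assms(2) obtain N C where N: "finite N" "\<And>\<alpha>. \<alpha> \<in> N \<Longrightarrow> smooth_on V (C \<alpha>)"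
    "\<And>x y. x \<in> V \<Longrightarrow> P x y = (\<Sum>\<alpha>\<in>N. C \<alpha> x * (\<Prod>i\<in>UNIV. (y $ i) ^ \<alpha> i))"
    unfolding smooth_polynomial_def by blast
  from assms(3) obtain N' C' where N': "finite N'" "\<And>\<alpha>. \<alpha> \<in> N' \<Longrightarrow> smooth_on V (C' \<alpha>)"
    "\<And>x y. x \<in> V \<Longrightarrow> Q x y = (\<Sum>\<alpha>\<in>N'. C' \<alpha> x * (\<Prod>i\<in>UNIV. (y $ i) ^ \<alpha> i))"
    unfolding smooth_polynomial_def by blast
  show ?thesis
    \<comment> \<open>The disjoint sum keeps a multi-index common to \<open>N\<close> and
      \<open>N'\<close> as two separate terms, so no case distinction on overlaps arises.\<close>
    by (rule smooth_polynomialI[where I = "N <+> N'" and C = "case_sum C C'" and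
          \<alpha> = "case_sum id id"])
      (use N N' assms(1) in \<open>auto simp: sum.Plus\<close>)
qed

lemma smooth_polynomial_mult:
  assumes "open V" "smooth_polynomial V P" "smooth_polynomial V Q"
  shows "smooth_polynomial V (\<lambda>x y. P x y * Q x y)"
proof -
  from assms(2) obtain N C where N: "finite N" "\<And>\<alpha>. \<alpha> \<in> N \<Longrightarrow> smooth_on V (C \<alpha>)"
    "\<And>x y. x \<in> V \<Longrightarrow> P x y = (\<Sum>\<alpha>\<in>N. C \<alpha> x * (\<Prod>i\<in>UNIV. (y $ i) ^ \<alpha> i))"
    unfolding smooth_polynomial_def by blast
  from assms(3) obtain N' C' where N': "finite N'" "\<And>\<alpha>. \<alpha> \<in> N' \<Longrightarrow> smooth_on V (C' \<alpha>)"
    "\<And>x y. x \<in> V \<Longrightarrow> Q x y = (\<Sum>\<alpha>\<in>N'. C' \<alpha> x * (\<Prod>i\<in>UNIV. (y $ i) ^ \<alpha> i))"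
    unfolding smooth_polynomial_def by blast
  show ?thesis
  \<comment> \<open>Multiplying monomials adds exponents; different pairs may give the same
    multi-index, which indexing by pairs permits.\<close>
  proof (rule smooth_polynomialI[where I = "N \<times> N'" and C = "\<lambda>(\<alpha>, \<beta>) x. C \<alpha> x * C' \<beta> x" and
          \<alpha> = "\<lambda>(\<alpha>, \<beta>) i. \<alpha> i + \<beta> i"])
    fix x y assume "x \<in> V"
    then show "P x y * Q x y = (\<Sum>p\<in>N \<times> N'. (case p of (\<alpha>, \<beta>) \<Rightarrow> \<lambda>x. C \<alpha> x * C' \<beta> x) x *
        (\<Prod>j\<in>UNIV. (y $ j) ^ (case p of (\<alpha>, \<beta>) \<Rightarrow> \<lambda>i. \<alpha> i + \<beta> i) j))"
      by (simp add: N N' sum_product sum.cartesian_product power_add prod.distrib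
          case_prod_unfold mult.assoc mult.left_commute[of "C' _ _"])
  qed (use N N' assms(1) in \<open>auto intro: smooth_on_mult\<close>)
qed

section \<open>Base derivatives of polynomials in the fibre coordinates\<close>

lemma dx_eq: "(f has_derivative f') (at z) \<Longrightarrow> dx k f z = f' (axis k 1, 0)"
  by (simp add: dx_def frechet_derivative_eq)

lemma dy_eq: "(f has_derivative f') (at z) \<Longrightarrow> dy k f z = f' (0, axis k 1)"
  by (simp add: dy_def frechet_derivative_eq)

lemma monomial_differentiable:
  fixes \<alpha> :: "'n::finite \<Rightarrow> nat" and y :: "real ^ 'n"
  shows "(\<lambda>y. \<Prod>j\<in>J. (y $ j) ^ \<alpha> j) differentiable (at y)"
  by (induction J rule: infinite_finite_induct)
    (auto intro!: differentiable_mult differentiable_power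
      bounded_linear_imp_differentiable[OF bounded_linear_vec_nth])

text \<open>An \<open>x\<close>-derivative acts only on the coefficients and leaves the monomials
  alone. The total derivative is provided too, because the quotient rule is applied to it
  later.\<close>

lemma smooth_polynomial_has_derivative:
  assumes "open V" "smooth_polynomial V P"
  obtains P' where "smooth_polynomial V P'" "\<forall>x\<in>V. \<forall>y. \<exists>D.
    ((\<lambda>z. P (fst z) (snd z)) has_derivative D) (at (x, y)) \<and> D (axis k 1, 0) = P' x y"
proof -
  from assms(2) obtain N C where N: "finite N" "\<And>\<alpha>. \<alpha> \<in> N \<Longrightarrow> smooth_on V (C \<alpha>)"
    and P: "\<And>x y. x \<in> V \<Longrightarrow> P x y = (\<Sum>\<alpha>\<in>N. C \<alpha> x * (\<Prod>i\<in>UNIV. (y $ i) ^ \<alpha> i))"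
    unfolding smooth_polynomial_def by blast
  define P' where "P' x y = (\<Sum>\<alpha>\<in>N. frechet_derivative (C \<alpha>) (at x) (axis k 1) * (\<Prod>i\<in>UNIV. (y $ i) ^ \<alpha> i))"
    for x y
  have "smooth_polynomial V P'"
    unfolding smooth_polynomial_def P'_def
    using N by (intro exI[of _ N] exI[of _ "\<lambda>\<alpha> x. frechet_derivative (C \<alpha>) (at x) (axis k 1)"])
      (auto intro: smooth_on_frechet_derivative)
  moreover have "\<exists>D. ((\<lambda>z. P (fst z) (snd z)) has_derivative D) (at (x, y)) \<and> D (axis k 1, 0) = P' x y"
    if x: "x \<in> V" for x y
  proof -
    define m where "m \<alpha> y = (\<Prod>i\<in>UNIV. (y $ i) ^ \<alpha> i)" for \<alpha> and y :: "real ^ 'a"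
    define m' where "m' \<alpha> = frechet_derivative (m \<alpha>) (at y)" for \<alpha>
    have m': "(m \<alpha> has_derivative m' \<alpha>) (at y)" for \<alpha>
      unfolding m'_def frechet_derivative_works[symmetric] m_def by (rule monomial_differentiable)
    have C': "(C \<alpha> has_derivative frechet_derivative (C \<alpha>) (at x)) (at x)" if "\<alpha> \<in> N" for \<alpha>
      using N x that smooth_on_imp_differentiable frechet_derivative_works by blast
    \<comment> \<open>The product rule, term by term. On \<open>(axis k 1, 0)\<close> the summands
      with \<open>m'\<close> vanish by linearity.\<close>
    define D where "D h = (\<Sum>\<alpha>\<in>N. C \<alpha> x * m' \<alpha> (snd h) + frechet_derivative (C \<alpha>) (at x) (fst h) * m \<alpha> y)"
      for h
    have "((\<lambda>z. \<Sum>\<alpha>\<in>N. C \<alpha> (fst z) * m \<alpha> (snd z)) has_derivative D) (at (x, y))"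
      unfolding D_def
    proof (rule has_derivative_sum)
      fix \<alpha> assume "\<alpha> \<in> N"
      have "((\<lambda>z. C \<alpha> (fst z)) has_derivative (\<lambda>h. frechet_derivative (C \<alpha>) (at x) (fst h))) (at (x, y))"
        by (rule has_derivative_compose[OF bounded_linear_imp_has_derivative[OF bounded_linear_fst]])
          (use C'[OF \<open>\<alpha> \<in> N\<close>] in simp)
      moreover have "((\<lambda>z. m \<alpha> (snd z)) has_derivative (\<lambda>h. m' \<alpha> (snd h))) (at (x, y))"
        by (rule has_derivative_compose[OF bounded_linear_imp_has_derivative[OF bounded_linear_snd]])
          (use m' in simp)
      ultimately show "((\<lambda>z. C \<alpha> (fst z) * m \<alpha> (snd z)) has_derivative
          (\<lambda>h. C \<alpha> x * m' \<alpha> (snd h) + frechet_derivative (C \<alpha>) (at x) (fst h) * m \<alpha> y)) (at (x, y))"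
        by (rule has_derivative_eq_rhs[OF has_derivative_mult]) auto
    qed
    then have "((\<lambda>z. P (fst z) (snd z)) has_derivative D) (at (x, y))"
      by (rule has_derivative_transform_within_open[where s = "V \<times> UNIV"])
        (use x assms(1) in \<open>auto simp: P m_def intro: open_Times\<close>)
    moreover have "D (axis k 1, 0) = P' x y"
      using has_derivative_linear[OF m'] by (simp add: D_def P'_def m_def linear_0)
    ultimately show ?thesis by blast
  qed
  ultimately show thesis by (intro that) auto
qed

section \<open>Closure properties of functions rational in the fibre coordinates\<close>

lemma rational_in_yE:
  assumes "rational_in_y X f" "x0 \<in> X"
  obtains V P Q where "open V" "x0 \<in> V" "V \<subseteq> X" "smooth_polynomial V P" "smooth_polynomial V Q"
    "\<forall>x\<in>V. \<forall>y. y \<noteq> 0 \<longrightarrow> Q x y \<noteq> 0 \<and> f (x, y) = P x y / Q x y"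
  using assms(1)[unfolded rational_in_y_def, THEN bspec, OF assms(2)] by (elim exE conjE)

lemma rational_in_yI:
  assumes "\<And>x0. x0 \<in> X \<Longrightarrow> \<exists>V P Q. open V \<and> x0 \<in> V \<and> V \<subseteq> X \<and>
    smooth_polynomial V P \<and> smooth_polynomial V Q \<and>
    (\<forall>x\<in>V. \<forall>y. y \<noteq> 0 \<longrightarrow> Q x y \<noteq> 0 \<and> f (x, y) = P x y / Q x y)"
  shows "rational_in_y X f"
  unfolding rational_in_y_def using assms by (rule ballI)

lemma rational_in_y_cong:
  assumes eq: "\<And>x y. x \<in> X \<Longrightarrow> y \<noteq> 0 \<Longrightarrow> f (x, y) = g (x, y)" and f: "rational_in_y X f"
  shows "rational_in_y X g"
proof (rule rational_in_yI)
  fix x0 assume "x0 \<in> X"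
  from f this obtain V P Q where "open V" "x0 \<in> V" "V \<subseteq> X"
    "smooth_polynomial V P" "smooth_polynomial V Q"
    "\<forall>x\<in>V. \<forall>y. y \<noteq> 0 \<longrightarrow> Q x y \<noteq> 0 \<and> f (x, y) = P x y / Q x y"
    by (rule rational_in_yE)
  then show "\<exists>V P Q. open V \<and> x0 \<in> V \<and> V \<subseteq> X \<and> smooth_polynomial V P \<and> smooth_polynomial V Q \<and>
        (\<forall>x\<in>V. \<forall>y. y \<noteq> 0 \<longrightarrow> Q x y \<noteq> 0 \<and> g (x, y) = P x y / Q x y)"
    by (intro exI[of _ V] exI[of _ P] exI[of _ Q]) (simp add: eq[symmetric] subset_eq)
qed

text \<open>Two functions come with different neighbourhoods of \<open>x0\<close>; restriction to
  the intersection lets their representations be combined.\<close>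

lemma rational_in_y_common_nhd:
  assumes "rational_in_y X f" "rational_in_y X g" "x0 \<in> X"
  obtains V P Q P' Q' where "open V" "x0 \<in> V" "V \<subseteq> X"
    "smooth_polynomial V P" "smooth_polynomial V Q" "smooth_polynomial V P'" "smooth_polynomial V Q'"
    "\<forall>x\<in>V. \<forall>y. y \<noteq> 0 \<longrightarrow> Q x y \<noteq> 0 \<and> Q' x y \<noteq> 0 \<and> f (x, y) = P x y / Q x y \<and> g (x, y) = P' x y / Q' x y"
proof -
  from assms(1,3) obtain V P Q where V: "open V" "x0 \<in> V" "V \<subseteq> X"
    "smooth_polynomial V P" "smooth_polynomial V Q"
    "\<forall>x\<in>V. \<forall>y. y \<noteq> 0 \<longrightarrow> Q x y \<noteq> 0 \<and> f (x, y) = P x y / Q x y"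
    by (rule rational_in_yE)
  from assms(2,3) obtain V' P' Q' where V': "open V'" "x0 \<in> V'" "V' \<subseteq> X"
    "smooth_polynomial V' P'" "smooth_polynomial V' Q'"
    "\<forall>x\<in>V'. \<forall>y. y \<noteq> 0 \<longrightarrow> Q' x y \<noteq> 0 \<and> g (x, y) = P' x y / Q' x y"
    by (rule rational_in_yE)
  show thesis
  proof (rule that[of "V \<inter> V'" P Q P' Q'])
    show "smooth_polynomial (V \<inter> V') P" "smooth_polynomial (V \<inter> V') Q"
      "smooth_polynomial (V \<inter> V') P'" "smooth_polynomial (V \<inter> V') Q'"
      using V V' smooth_polynomial_subset by (meson inf_le1 inf_le2)+
  qed (use V V' in auto)
qed

lemma rational_in_y_const: "open X \<Longrightarrow> rational_in_y X (\<lambda>_. r)"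
  by (intro rational_in_yI exI[of _ X] exI[of _ "\<lambda>_ _. r"] exI[of _ "\<lambda>_ _. 1"])
    (auto intro: smooth_polynomial_const)

lemma rational_in_y_snd_component: "open X \<Longrightarrow> rational_in_y X (\<lambda>z. snd z $ k)"
  by (intro rational_in_yI exI[of _ X] exI[of _ "\<lambda>_ y. y $ k"] exI[of _ "\<lambda>_ _. 1"])
    (auto intro: smooth_polynomial_const smooth_polynomial_component)

lemma rational_in_y_add:
  assumes "rational_in_y X f" "rational_in_y X g"
  shows "rational_in_y X (\<lambda>z. f z + g z)"
proof (rule rational_in_yI)
  fix x0 assume "x0 \<in> X"
  from this obtain V P Q P' Q' where V: "open V" "x0 \<in> V" "V \<subseteq> X"
    "smooth_polynomial V P" "smooth_polynomial V Q" "smooth_polynomial V P'" "smooth_polynomial V Q'"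
    "\<forall>x\<in>V. \<forall>y. y \<noteq> 0 \<longrightarrow> Q x y \<noteq> 0 \<and> Q' x y \<noteq> 0 \<and> f (x, y) = P x y / Q x y \<and> g (x, y) = P' x y / Q' x y"
    by (rule rational_in_y_common_nhd[OF assms])
  then show "\<exists>V P Q. open V \<and> x0 \<in> V \<and> V \<subseteq> X \<and> smooth_polynomial V P \<and> smooth_polynomial V Q \<and>
        (\<forall>x\<in>V. \<forall>y. y \<noteq> 0 \<longrightarrow> Q x y \<noteq> 0 \<and> f (x, y) + g (x, y) = P x y / Q x y)"
    by (intro exI[of _ V] exI[of _ "\<lambda>x y. P x y * Q' x y + P' x y * Q x y"] exI[of _ "\<lambda>x y. Q x y * Q' x y"])
      (simp add: smooth_polynomial_add smooth_polynomial_mult add_frac_eq)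
qed

lemma rational_in_y_mult:
  assumes "rational_in_y X f" "rational_in_y X g"
  shows "rational_in_y X (\<lambda>z. f z * g z)"
proof (rule rational_in_yI)
  fix x0 assume "x0 \<in> X"
  from this obtain V P Q P' Q' where V: "open V" "x0 \<in> V" "V \<subseteq> X"
    "smooth_polynomial V P" "smooth_polynomial V Q" "smooth_polynomial V P'" "smooth_polynomial V Q'"
    "\<forall>x\<in>V. \<forall>y. y \<noteq> 0 \<longrightarrow> Q x y \<noteq> 0 \<and> Q' x y \<noteq> 0 \<and> f (x, y) = P x y / Q x y \<and> g (x, y) = P' x y / Q' x y"
    by (rule rational_in_y_common_nhd[OF assms])
  then show "\<exists>V P Q. open V \<and> x0 \<in> V \<and> V \<subseteq> X \<and> smooth_polynomial V P \<and> smooth_polynomial V Q \<and>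
        (\<forall>x\<in>V. \<forall>y. y \<noteq> 0 \<longrightarrow> Q x y \<noteq> 0 \<and> f (x, y) * g (x, y) = P x y / Q x y)"
    by (intro exI[of _ V] exI[of _ "\<lambda>x y. P x y * P' x y"] exI[of _ "\<lambda>x y. Q x y * Q' x y"])
      (simp add: smooth_polynomial_mult)
qed

text \<open>The numerator of \<open>g\<close> enters the new denominator; as \<open>g\<close> has no
  zeros for \<open>y \<noteq> 0\<close>, neither does that numerator.\<close>

lemma rational_in_y_divide:
  assumes "rational_in_y X f" "rational_in_y X g"
    and g: "\<And>x y. x \<in> X \<Longrightarrow> y \<noteq> 0 \<Longrightarrow> g (x, y) \<noteq> 0"
  shows "rational_in_y X (\<lambda>z. f z / g z)"
proof (rule rational_in_yI)
  fix x0 assume "x0 \<in> X"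
  from this obtain V P Q P' Q' where V: "open V" "x0 \<in> V" "V \<subseteq> X"
    "smooth_polynomial V P" "smooth_polynomial V Q" "smooth_polynomial V P'" "smooth_polynomial V Q'" and
    eq: "\<forall>x\<in>V. \<forall>y. y \<noteq> 0 \<longrightarrow> Q x y \<noteq> 0 \<and> Q' x y \<noteq> 0 \<and> f (x, y) = P x y / Q x y \<and> g (x, y) = P' x y / Q' x y"
    by (rule rational_in_y_common_nhd[OF assms(1,2)])
  have "P' x y \<noteq> 0" if "x \<in> V" "y \<noteq> 0" for x y
    using eq that g[of x y] V(3) that by auto
  with V eq show "\<exists>V P Q. open V \<and> x0 \<in> V \<and> V \<subseteq> X \<and> smooth_polynomial V P \<and> smooth_polynomial V Q \<and>
        (\<forall>x\<in>V. \<forall>y. y \<noteq> 0 \<longrightarrow> Q x y \<noteq> 0 \<and> f (x, y) / g (x, y) = P x y / Q x y)"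
    by (intro exI[of _ V] exI[of _ "\<lambda>x y. P x y * Q' x y"] exI[of _ "\<lambda>x y. Q x y * P' x y"])
      (simp add: smooth_polynomial_mult)
qed

lemma rational_in_y_diff:
  assumes "open X" "rational_in_y X f" "rational_in_y X g"
  shows "rational_in_y X (\<lambda>z. f z - g z)"
  using rational_in_y_add[OF assms(2) rational_in_y_mult[OF rational_in_y_const[OF assms(1), of "-1"] assms(3)]]
  by simp

lemma rational_in_y_sum:
  assumes "open X" "\<And>i. i \<in> I \<Longrightarrow> rational_in_y X (f i)"
  shows "rational_in_y X (\<lambda>z. \<Sum>i\<in>I. f i z)"
  using assms(2)
  by (induction I rule: infinite_finite_induct)
    (auto intro: rational_in_y_const rational_in_y_add assms(1))

lemma rational_in_y_prod:
  assumes "open X" "\<And>i. i \<in> I \<Longrightarrow> rational_in_y X (f i)"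
  shows "rational_in_y X (\<lambda>z. \<Prod>i\<in>I. f i z)"
  using assms(2)
  by (induction I rule: infinite_finite_induct)
    (auto intro: rational_in_y_const rational_in_y_mult assms(1))

text \<open>Leibniz's formula writes the determinant as a finite sum of products of entries. This
  prepares Cramer's rule.\<close>

lemma rational_in_y_det:
  fixes B :: "(real ^ 'n::finite) \<times> (real ^ 'n) \<Rightarrow> real ^ 'm ^ 'm"
  assumes "open X" "\<And>i j. rational_in_y X (\<lambda>z. B z $ i $ j)"
  shows "rational_in_y X (\<lambda>z. det (B z))"
  unfolding det_def
  by (intro rational_in_y_sum rational_in_y_mult rational_in_y_const rational_in_y_prod assms)

lemma rational_in_y_differentiable_dx:
  fixes X :: "(real ^ 'n::finite) set"
  assumes "rational_in_y X f" "x0 \<in> X"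
  obtains V P Q where "open V" "x0 \<in> V" "V \<subseteq> X" "smooth_polynomial V P" "smooth_polynomial V Q"
    "\<forall>x\<in>V. \<forall>y. y \<noteq> 0 \<longrightarrow> Q x y \<noteq> 0 \<and>
       f differentiable (at (x, y)) \<and> dx k f (x, y) = P x y / Q x y"
proof -
  from assms obtain V P Q where V: "open V" "x0 \<in> V" "V \<subseteq> X"
    "smooth_polynomial V P" "smooth_polynomial V Q"
    and f: "\<forall>x\<in>V. \<forall>y. y \<noteq> 0 \<longrightarrow> Q x y \<noteq> 0 \<and> f (x, y) = P x y / Q x y"
    by (rule rational_in_yE)
  obtain P' where P': "smooth_polynomial V P'" "\<forall>x\<in>V. \<forall>y. \<exists>D.
    ((\<lambda>z. P (fst z) (snd z)) has_derivative D) (at (x, y)) \<and> D (axis k 1, 0) = P' x y"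
    by (rule smooth_polynomial_has_derivative[OF V(1,4), where k = k])
  obtain Q' where Q': "smooth_polynomial V Q'" "\<forall>x\<in>V. \<forall>y. \<exists>D.
    ((\<lambda>z. Q (fst z) (snd z)) has_derivative D) (at (x, y)) \<and> D (axis k 1, 0) = Q' x y"
    by (rule smooth_polynomial_has_derivative[OF V(1,5), where k = k])
  \<comment> \<open>The quotient rule, with the difference in the numerator written through the
    factor -1 so that closure under sums and products suffices.\<close>
  have dx: "\<forall>x\<in>V. \<forall>y. y \<noteq> 0 \<longrightarrow> Q x y * Q x y \<noteq> 0 \<and> f differentiable (at (x, y)) \<and>
      dx k f (x, y) = (P' x y * Q x y + (-1) * (P x y * Q' x y)) / (Q x y * Q x y)"
  proof (intro ballI allI impI)
    fix x and y :: "real ^ 'n" assume xy: "x \<in> V" "y \<noteq> 0"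
    obtain D1 where D1: "((\<lambda>z. P (fst z) (snd z)) has_derivative D1) (at (x, y))" "D1 (axis k 1, 0) = P' x y"
      using P'(2) xy by blast
    obtain D2 where D2: "((\<lambda>z. Q (fst z) (snd z)) has_derivative D2) (at (x, y))" "D2 (axis k 1, 0) = Q' x y"
      using Q'(2) xy by blast
    have "((\<lambda>z. P (fst z) (snd z) / Q (fst z) (snd z)) has_derivative
        (\<lambda>h. (D1 h * Q x y - P x y * D2 h) / (Q x y * Q x y))) (at (x, y))"
      using has_derivative_divide'[OF D1(1) D2(1)] f xy by auto
    \<comment> \<open>The quotient represents \<open>f\<close> only over \<open>V\<close> and away
      from \<open>y = 0\<close>; that set is open, so the derivative transfers.\<close>
    then have "(f has_derivative (\<lambda>h. (D1 h * Q x y - P x y * D2 h) / (Q x y * Q x y))) (at (x, y))"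
    proof (rule has_derivative_transform_within_open)
      show "open (V \<times> (UNIV - {0 :: real ^ 'n}))"
        by (intro open_Times open_delete open_UNIV V(1))
    qed (use f xy in \<open>auto simp: split_paired_all\<close>)
    then show "Q x y * Q x y \<noteq> 0 \<and> f differentiable (at (x, y)) \<and>
        dx k f (x, y) = (P' x y * Q x y + (-1) * (P x y * Q' x y)) / (Q x y * Q x y)"
      using f xy D1 D2 by (auto simp: differentiable_def dx_eq)
  qed
  show thesis
    by (rule that[OF V(1-3) _ _ dx])
      (intro smooth_polynomial_add smooth_polynomial_mult smooth_polynomial_const V P' Q')+
qed

lemma rational_in_y_imp_differentiable:
  "rational_in_y X f \<Longrightarrow> x \<in> X \<Longrightarrow> y \<noteq> 0 \<Longrightarrow> f differentiable (at (x, y))"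
  \<comment> \<open>Differentiability comes with any direction \<open>k\<close>, so an arbitrary one
    serves.\<close>
  by (erule (1) rational_in_y_differentiable_dx[where k = undefined])
    auto

lemma rational_in_y_dx:
  assumes "rational_in_y X f"
  shows "rational_in_y X (dx k f)"
proof (rule rational_in_yI)
  fix x0 assume "x0 \<in> X"
  from assms this obtain V P Q where "open V" "x0 \<in> V" "V \<subseteq> X"
    "smooth_polynomial V P" "smooth_polynomial V Q"
    "\<forall>x\<in>V. \<forall>y. y \<noteq> 0 \<longrightarrow> Q x y \<noteq> 0 \<and>
       f differentiable (at (x, y)) \<and> dx k f (x, y) = P x y / Q x y"
    by (rule rational_in_y_differentiable_dx[where k = k])
  then show "\<exists>V P Q. open V \<and> x0 \<in> V \<and> V \<subseteq> X \<and> smooth_polynomial V P \<and> smooth_polynomial V Q \<and>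
        (\<forall>x\<in>V. \<forall>y. y \<noteq> 0 \<longrightarrow> Q x y \<noteq> 0 \<and> dx k f (x, y) = P x y / Q x y)"
    by (intro exI[of _ V] exI[of _ P] exI[of _ Q]) simp
qed

section \<open>Induced coordinates on the tangent bundle\<close>

text \<open>A chart is a homeomorphism onto an open set, and openness relative to an open set is
  openness in the whole space.\<close>

lemma chart_image_open:
  assumes "is_chart M c" "openin M U" "U \<subseteq> fst c"
  shows "open (snd c ` U)"
proof -
  have "openin (subtopology M (fst c)) U"
    using assms(2,3) by (auto simp: openin_subtopology)
  moreover have "open_map (subtopology M (fst c)) (top_of_set (snd c ` fst c)) (snd c)"
    using assms(1) by (simp add: is_chart_def homeomorphic_imp_open_map)
  ultimately show ?thesis
    using assms(1) by (auto simp: open_map_def is_chart_def openin_open_eq)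
qed

lemma chart_inj_on:
  assumes "is_chart M c"
  shows "inj_on (snd c) (fst c)"
proof -
  have "fst c \<subseteq> topspace M"
    using assms by (simp add: is_chart_def openin_subset)
  then show ?thesis
    using assms homeomorphic_imp_injective_map[of "subtopology M (fst c)" _ "snd c"]
    by (auto simp: is_chart_def inf_absorb2)
qed

context
  fixes M :: "'m topology" and A :: "('m, 'n::finite) chart set"
  assumes manifold: "smooth_manifold M A"
begin

lemma atlas_is_chart: "c \<in> A \<Longrightarrow> is_chart M c"
  using manifold by (simp add: smooth_manifold_def)

lemma atlas_openin: "c \<in> A \<Longrightarrow> openin M (fst c)"
  using atlas_is_chart by (simp add: is_chart_def)

lemma transition_apply: "c \<in> A \<Longrightarrow> p \<in> fst c \<Longrightarrow> transition c d (snd c p) = snd d p"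
  using chart_inj_on[OF atlas_is_chart] by (simp add: transition_def)

lemma transition_has_derivative:
  assumes "c \<in> A" "d \<in> A" "p \<in> fst c" "p \<in> fst d"
  shows "(transition c d has_derivative frechet_derivative (transition c d) (at (snd c p))) (at (snd c p))"
proof -
  have "smoothly_compatible c d"
    using manifold assms by (simp add: smooth_manifold_def)
  then have "smooth_on (snd c ` (fst c \<inter> fst d)) (transition c d)"
    by (simp add: smoothly_compatible_def)
  then have "transition c d differentiable (at (snd c p))"
    by (rule smooth_on_imp_differentiable) (use assms in auto)
  then show ?thesis by (simp add: frechet_derivative_works)
qed

text \<open>The chain rule. The transition maps compose as expected on the image of the triple
  overlap, which is an open neighbourhood of the point in question.\<close>

lemma frechet_derivative_transition_cocycle:
  assumes "c \<in> A" "d \<in> A" "e \<in> A" "p \<in> fst c" "p \<in> fst d" "p \<in> fst e"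
  shows "frechet_derivative (transition c e) (at (snd c p)) y =
    frechet_derivative (transition d e) (at (snd d p)) (frechet_derivative (transition c d) (at (snd c p)) y)"
proof -
  have "transition c d (snd c p) = snd d p"
    using assms by (simp add: transition_apply)
  then have "((\<lambda>x. transition d e (transition c d x)) has_derivative
      (\<lambda>y. frechet_derivative (transition d e) (at (snd d p)) (frechet_derivative (transition c d) (at (snd c p)) y)))
      (at (snd c p))"
    using has_derivative_compose[OF transition_has_derivative[of c d p]] transition_has_derivative[of d e p] assms
    by simp
  then have "(transition c e has_derivative
      (\<lambda>y. frechet_derivative (transition d e) (at (snd d p)) (frechet_derivative (transition c d) (at (snd c p)) y)))
      (at (snd c p))"
  proof (rule has_derivative_transform_within_open)
    show "open (snd c ` (fst c \<inter> fst d \<inter> fst e))"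
      by (rule chart_image_open[OF atlas_is_chart]) (auto intro!: openin_Int atlas_openin assms)
  qed (use assms in \<open>auto simp: transition_apply\<close>)
  then show ?thesis by (simp add: frechet_derivative_eq)
qed

lemma frechet_derivative_transition_self:
  assumes "c \<in> A" "p \<in> fst c"
  shows "frechet_derivative (transition c c) (at (snd c p)) y = y"
proof -
  have "(transition c c has_derivative (\<lambda>y. y)) (at (snd c p))"
  proof (rule has_derivative_transform_within_open[OF has_derivative_ident])
    show "open (snd c ` fst c)"
      by (rule chart_image_open[OF atlas_is_chart]) (use assms atlas_openin in auto)
  qed (use assms in \<open>auto simp: transition_apply\<close>)
  then show ?thesis by (simp add: frechet_derivative_eq)
qed

lemma tangent_space_component:
  "v \<in> tangent_space A p \<Longrightarrow> c \<in> A \<Longrightarrow> d \<in> A \<Longrightarrow> p \<in> fst c \<Longrightarrow> p \<in> fst d \<Longrightarrow>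
    v d = frechet_derivative (transition c d) (at (snd c p)) (v c)"
  unfolding tangent_space_def by blast

lemma tangent_space_component_outside:
  "v \<in> tangent_space A p \<Longrightarrow> \<not> (c \<in> A \<and> p \<in> fst c) \<Longrightarrow> v c = 0"
  unfolding tangent_space_def by blast

text \<open>Surjectivity of the fibre coordinates: the prescribed component is carried to all other
  charts by the Jacobians, and the cocycle identity makes the family consistent.\<close>

lemma tangent_vector_with_components:
  assumes "c \<in> A" "p \<in> fst c"
  obtains v where "v \<in> tangent_space A p" "v c = y"
proof
  let ?v = "\<lambda>d. if d \<in> A \<and> p \<in> fst d then frechet_derivative (transition c d) (at (snd c p)) y else 0"
  show "?v \<in> tangent_space A p"
    using assms by (auto simp: tangent_space_def intro: frechet_derivative_transition_cocycle)
  show "?v c = y"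
    using assms by (simp add: frechet_derivative_transition_self)
qed

lemma tangent_space_scaleR:
  assumes "v \<in> tangent_space A p"
  shows "(\<lambda>c. t *\<^sub>R v c) \<in> tangent_space A p"
proof -
  have "t *\<^sub>R v d = frechet_derivative (transition c d) (at (snd c p)) (t *\<^sub>R v c)"
    if "c \<in> A" "d \<in> A" "p \<in> fst c" "p \<in> fst d" for c d
    using has_derivative_linear[OF transition_has_derivative[OF that]]
      tangent_space_component[OF assms that] by (simp add: linear_cmul)
  moreover have "t *\<^sub>R v c = 0" if "\<not> (c \<in> A \<and> p \<in> fst c)" for c
    using tangent_space_component_outside[OF assms that] by simp
  ultimately show ?thesis unfolding tangent_space_def by blast
qed

text \<open>One component determines a tangent vector, as the others are its Jacobian images or 0 by
  convention. Hence \<open>inv_into\<close> in \<open>local_expr\<close> is a genuine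
  inverse.\<close>

lemma induced_coords_inj_on:
  assumes c: "c \<in> A"
  shows "inj_on (induced_coords c) (SIGMA p:fst c. tangent_space A p)"
proof (rule inj_onI)
  fix z z'
  assume z: "z \<in> (SIGMA p:fst c. tangent_space A p)" and z': "z' \<in> (SIGMA p:fst c. tangent_space A p)"
    and coords: "induced_coords c z = induced_coords c z'"
  obtain p v where pv: "z = (p, v)" by (rule prod.exhaust)
  obtain q w where qw: "z' = (q, w)" by (rule prod.exhaust)
  have p: "p \<in> fst c" and v: "v \<in> tangent_space A p" and q: "q \<in> fst c" and w: "w \<in> tangent_space A q"
    using z z' unfolding pv qw by simp_all
  have eq: "snd c p = snd c q" "v c = w c"
    using coords unfolding pv qw induced_coords_def by simp_all
  then have pq: "p = q"
    by (intro inj_onD[OF chart_inj_on[OF atlas_is_chart[OF c]] _ p q])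
  have "v d = w d" for d
  proof (cases "d \<in> A \<and> p \<in> fst d")
    case True
    then show ?thesis
      using tangent_space_component[OF v c, of d] tangent_space_component[OF w c, of d] p eq pq by simp
  next
    case False
    then show ?thesis
      using tangent_space_component_outside[OF v, of d] tangent_space_component_outside[OF w, of d] pq by simp
  qed
  then have "v = w" by (rule ext)
  with pq show "z = z'" by (simp only: pv qw)
qed

lemma local_expr_apply:
  assumes "c \<in> A" "p \<in> fst c" "v \<in> tangent_space A p"
  shows "local_expr A c f (snd c p, v c) = f (p, v)"
proof -
  have "inv_into (SIGMA p:fst c. tangent_space A p) (induced_coords c) (induced_coords c (p, v)) = (p, v)"
    by (rule inv_into_f_f[OF induced_coords_inj_on[OF assms(1)]]) (simp add: assms)
  then show ?thesis by (simp add: local_expr_def induced_coords_def)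
qed

lemma chart_coords_obtain:
  assumes "c \<in> A" "x \<in> snd c ` fst c"
  obtains p v where "p \<in> fst c" "v \<in> tangent_space A p" "x = snd c p" "y = v c"
proof -
  from assms obtain p where p: "p \<in> fst c" "x = snd c p" by auto
  obtain v where v: "v \<in> tangent_space A p" "v c = y"
    using tangent_vector_with_components[OF assms(1) p(1)] .
  show thesis
    by (rule that[OF p(1) v(1) p(2) v(2)[symmetric]])
qed

lemma mem_tangent_bundle:
  assumes "c \<in> A" "p \<in> fst c" "v \<in> tangent_space A p"
  shows "(p, v) \<in> tangent_bundle M A"
proof -
  have "p \<in> topspace M"
    using openin_subset[OF atlas_openin[OF assms(1)]] assms(2) by (rule subsetD)
  then show ?thesis
    unfolding tangent_bundle_def using assms(3) by (rule SigmaI)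
qed

text \<open>Scaling every component by \<open>t\<close> yields a tangent vector again, with fibre
  coordinate scaled by \<open>t\<close>; so homogeneity on the bundle passes to coordinates.\<close>

lemma finsler_local_homogeneous:
  assumes F: "finsler_metric M A F" and c: "c \<in> A" and x: "x \<in> snd c ` fst c" and t: "t > 0"
  shows "local_expr A c F (x, t *\<^sub>R y) = t * local_expr A c F (x, y)"
proof -
  obtain p v where p: "p \<in> fst c" "v \<in> tangent_space A p" "x = snd c p" "y = v c"
    by (rule chart_coords_obtain[OF c x])
  have "local_expr A c F (x, t *\<^sub>R y) = F (p, \<lambda>c. t *\<^sub>R v c)"
    using local_expr_apply[OF c p(1) tangent_space_scaleR[OF p(2)]] p by simp
  also have "\<dots> = t * F (p, v)"
    using F t mem_tangent_bundle[OF c p(1,2)] by (auto simp: finsler_metric_def)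
  finally show ?thesis
    using local_expr_apply[OF c p(1,2), of F] p(3,4) by simp
qed

lemma local_expr_nonneg:
  assumes "\<forall>w\<in>slit_tangent_bundle M A. 0 \<le> \<eta> w" and c: "c \<in> A" and x: "x \<in> snd c ` fst c" and "y \<noteq> 0"
  shows "0 \<le> local_expr A c \<eta> (x, y)"
proof -
  obtain p v where p: "p \<in> fst c" "v \<in> tangent_space A p" "x = snd c p" "y = v c"
    by (rule chart_coords_obtain[OF c x])
  have "(p, v) \<in> slit_tangent_bundle M A"
    using mem_tangent_bundle[OF c p(1,2)] p(4) \<open>y \<noteq> 0\<close> by (auto simp: slit_tangent_bundle_def)
  with assms(1) show ?thesis
    using local_expr_apply[OF c p(1,2), of \<eta>] p(3,4) by simp
qed

end

section \<open>Partial derivatives and homogeneity\<close>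

lemma dx_cong:
  assumes "open S" "z \<in> S" "\<And>w. w \<in> S \<Longrightarrow> f w = g w" "f differentiable (at z)"
  shows "dx k f z = dx k g z"
  using frechet_derivative_transform_within_open[OF assms(4,1,2,3)] by (simp add: dx_def)

lemma dx_mult:
  assumes "f differentiable (at z)" "g differentiable (at z)"
  shows "dx k (\<lambda>w. f w * g w) z = f z * dx k g z + dx k f z * g z"
proof -
  from assms obtain f' g' where "(f has_derivative f') (at z)" "(g has_derivative g') (at z)"
    by (auto simp: differentiable_def)
  then show ?thesis
    by (simp add: dx_eq dx_eq[OF has_derivative_mult])
qed

lemma dx_ln:
  assumes "f differentiable (at z)" "f z > 0"
  shows "dx k (\<lambda>w. ln (f w)) z = dx k f z / f z"
proof -
  from assms obtain f' where f': "(f has_derivative f') (at z)"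
    by (auto simp: differentiable_def)
  have "((\<lambda>w. ln (f w)) has_derivative (\<lambda>h. f' h * inverse (f z))) (at z)"
    using has_derivative_ln[OF assms(2) f'] .
  from dx_eq[OF this] dx_eq[OF f'] show ?thesis by (simp add: divide_inverse)
qed

lemma has_derivative_snd_direction:
  fixes D :: "(real ^ 'n::finite) \<times> (real ^ 'n) \<Rightarrow> real"
  assumes "(f has_derivative D) (at (x, y))"
  shows "D (0, v) = (\<Sum>r\<in>UNIV. v $ r * dy r f (x, y))"
proof -
  note lin = has_derivative_linear[OF assms]
  have "(0, v) = (\<Sum>r\<in>UNIV. v $ r *\<^sub>R (0 :: real ^ 'n, axis r 1))"
    by (simp add: prod_eq_iff fst_sum snd_sum vec_eq_iff axis_def if_distrib cong: if_cong)
  then have "D (0, v) = (\<Sum>r\<in>UNIV. D (v $ r *\<^sub>R (0, axis r 1)))"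
    by (simp only: linear_sum[OF lin])
  then show ?thesis
    by (simp only: linear_cmul[OF lin] dy_eq[OF assms] real_scaleR_def)
qed

text \<open>Euler's theorem: the derivative of \<open>f (x, t *\<^sub>R y)\<close> in
  \<open>t\<close> at 1 is computed once by the chain rule and once from the power
  \<open>t ^ k\<close>, which represents the function on the open half-line
  \<open>t > 0\<close>.\<close>

lemma euler_homogeneous:
  fixes f :: "(real ^ 'n::finite) \<times> (real ^ 'n) \<Rightarrow> real"
  assumes "f differentiable (at (x, y))"
    and hom: "\<And>t. t > 0 \<Longrightarrow> f (x, t *\<^sub>R y) = t ^ k * f (x, y)"
  shows "(\<Sum>r\<in>UNIV. y $ r * dy r f (x, y)) = real k * f (x, y)"
proof -
  from assms(1) obtain D where D: "(f has_derivative D) (at (x, y))"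
    by (auto simp: differentiable_def)
  have "((\<lambda>t. (x, t *\<^sub>R y)) has_derivative (\<lambda>h. (0, h *\<^sub>R y))) (at 1)"
    by (auto intro!: derivative_eq_intros)
  then have "((\<lambda>t. f (x, t *\<^sub>R y)) has_derivative (\<lambda>h. D (0, h *\<^sub>R y))) (at 1)"
    by (rule has_derivative_compose) (use D in simp)
  then have "((\<lambda>t. t ^ k * f (x, y)) has_derivative (\<lambda>h. D (0, h *\<^sub>R y))) (at 1)"
    by (rule has_derivative_transform_within_open[where s = "{0<..}"]) (use hom in auto)
  moreover have "((\<lambda>t. t ^ k * f (x, y)) has_derivative (\<lambda>h. h * (real k * f (x, y)))) (at 1)"
    by (auto intro!: derivative_eq_intros)
  ultimately have "(\<lambda>h. D (0, h *\<^sub>R y)) = (\<lambda>h. h * (real k * f (x, y)))"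
    by (rule has_derivative_unique)
  from fun_cong[OF this, of 1] show ?thesis
    by (simp add: has_derivative_snd_direction[OF D])
qed

text \<open>Both sides of the homogeneity relation are differentiated in \<open>y\<close>. The chain
  rule yields one factor \<open>t\<close> on the left, which cancels against
  \<open>t ^ Suc k\<close>.\<close>

lemma dy_homogeneous:
  fixes f :: "(real ^ 'n::finite) \<times> (real ^ 'n) \<Rightarrow> real"
  assumes "open X" "x \<in> X" "y \<noteq> 0" "t > 0"
    and diff: "f differentiable (at (x, y))" "f differentiable (at (x, t *\<^sub>R y))"
    and hom: "\<And>x y. x \<in> X \<Longrightarrow> y \<noteq> 0 \<Longrightarrow> f (x, t *\<^sub>R y) = t ^ Suc k * f (x, y)"
  shows "dy r f (x, t *\<^sub>R y) = t ^ k * dy r f (x, y)"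
proof -
  from diff obtain D D' where D: "(f has_derivative D) (at (x, y))"
    and D': "(f has_derivative D') (at (x, t *\<^sub>R y))"
    by (auto simp: differentiable_def)
  have "((\<lambda>z. (fst z, t *\<^sub>R snd z)) has_derivative (\<lambda>h. (fst h, t *\<^sub>R snd h))) (at (x, y))"
    by (auto intro!: derivative_eq_intros)
  then have "((\<lambda>z. f (fst z, t *\<^sub>R snd z)) has_derivative (\<lambda>h. D' (fst h, t *\<^sub>R snd h))) (at (x, y))"
    by (rule has_derivative_compose) (use D' in simp)
  then have "((\<lambda>z. t ^ Suc k * f z) has_derivative (\<lambda>h. D' (fst h, t *\<^sub>R snd h))) (at (x, y))"
  proof (rule has_derivative_transform_within_open)
    show "open (X \<times> (UNIV - {0 :: real ^ 'n}))"
      by (intro open_Times open_delete open_UNIV assms(1))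
  qed (use hom assms(2,3) in \<open>simp_all add: split_paired_all del: power_Suc\<close>)
  moreover have "((\<lambda>z. t ^ Suc k * f z) has_derivative (\<lambda>h. t ^ Suc k * D h)) (at (x, y))"
    by (rule has_derivative_mult_right[OF D])
  ultimately have "(\<lambda>h. D' (fst h, t *\<^sub>R snd h)) = (\<lambda>h. t ^ Suc k * D h)"
    by (rule has_derivative_unique)
  from fun_cong[OF this, of "(0, axis r 1)"]
  have "D' (0, t *\<^sub>R axis r 1) = t ^ Suc k * D (0, axis r 1)" by simp
  moreover have "D' (0, t *\<^sub>R axis r 1) = t * D' (0, axis r 1)"
    using linear_cmul[OF has_derivative_linear[OF D'], of t "(0, axis r 1)"] by simp
  ultimately show ?thesis
    using \<open>t > 0\<close> by (simp add: dy_eq[OF D] dy_eq[OF D'])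
qed

section \<open>Invertibility of positive definite matrices\<close>

lemma pos_definite_det_nz:
  fixes B :: "real ^ 'n::finite ^ 'n"
  assumes "pos_definite B"
  shows "det B \<noteq> 0"
proof -
  have "B *v u = 0 \<Longrightarrow> u = 0" for u
    using assms by (force simp: pos_definite_def)
  then have "invertible B"
    by (auto simp: invertible_left_inverse matrix_left_invertible_ker)
  then show ?thesis by (simp add: invertible_det_nz)
qed

lemma matrix_inv_solves:
  fixes B :: "real ^ 'n::finite ^ 'n"
  assumes "det B \<noteq> 0"
  shows "B *v (matrix_inv B *v w) = w"
proof -
  have "invertible B" using assms by (simp add: invertible_det_nz)
  then have "B ** matrix_inv B = mat 1"
    \<comment> \<open>\<open>matrix_inv\<close> is a choice among inverses, so existence of one
      gives access to its defining property.\<close>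
    unfolding invertible_def matrix_inv_def by (rule someI2_ex) simp
  then show ?thesis by (simp add: matrix_vector_mul_assoc)
qed

section \<open>The spray of an AR-Finsler metric in coordinates\<close>

text \<open>The data seen in a single chart: \<open>X\<close> is the image of the chart domain, and
  \<open>F\<close>, \<open>\<eta>\<close> stand for local expressions.\<close>

locale local_AR_finsler =
  fixes X :: "(real ^ 'n::finite) set"
    and F \<eta> :: "(real ^ 'n) \<times> (real ^ 'n) \<Rightarrow> real"
    and a :: "(real ^ 'n) \<times> (real ^ 'n) \<Rightarrow> real ^ 'n ^ 'n"
  assumes open_X: "open X"
    and F_smooth: "smooth_on (X \<times> (UNIV - {0})) F"
    and F_homogeneous: "\<And>x y t. x \<in> X \<Longrightarrow> t > 0 \<Longrightarrow> F (x, t *\<^sub>R y) = t * F (x, y)"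
    and g_pos_definite: "\<And>x y. x \<in> X \<Longrightarrow> y \<noteq> 0 \<Longrightarrow> pos_definite (fundamental_tensor F (x, y))"
    and \<eta>_smooth: "smooth_on (X \<times> (UNIV - {0})) \<eta>"
    and \<eta>_nonneg: "\<And>x y. x \<in> X \<Longrightarrow> y \<noteq> 0 \<Longrightarrow> 0 \<le> \<eta> (x, y)"
    and a_rational: "\<And>i j. rational_in_y X (\<lambda>z. a z $ i $ j)"
    and a_symmetric: "\<And>x y. x \<in> X \<Longrightarrow> y \<noteq> 0 \<Longrightarrow> transpose (a (x, y)) = a (x, y)"
    and a_pos_definite: "\<And>x y. x \<in> X \<Longrightarrow> y \<noteq> 0 \<Longrightarrow> pos_definite (a (x, y))"
    and g_eq: "\<And>x y i j. x \<in> X \<Longrightarrow> y \<noteq> 0 \<Longrightarrow>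
      fundamental_tensor F (x, y) $ i $ j = \<eta> (x, y) * a (x, y) $ i $ j"
begin

definition S :: "((real ^ 'n) \<times> (real ^ 'n)) set" where
  "S = X \<times> (UNIV - {0})"

definition E :: "(real ^ 'n) \<times> (real ^ 'n) \<Rightarrow> real" where
  "E z = (F z)\<^sup>2"

definition b :: "'n \<Rightarrow> (real ^ 'n) \<times> (real ^ 'n) \<Rightarrow> real" where
  "b r z = (\<Sum>j\<in>UNIV. a z $ r $ j * snd z $ j)"

definition Q :: "(real ^ 'n) \<times> (real ^ 'n) \<Rightarrow> real" where
  "Q z = (\<Sum>r\<in>UNIV. snd z $ r * b r z)"

definition L :: "'n \<Rightarrow> (real ^ 'n) \<times> (real ^ 'n) \<Rightarrow> real" where
  "L k = dx k (\<lambda>z. ln (\<eta> z))"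

text \<open>The part of the bracket in which \<open>\<eta>\<close> is not differentiated; it is
  built from \<open>a\<close>, its \<open>x\<close>-derivatives and \<open>y\<close>, hence
  rational.\<close>

definition H :: "'n \<Rightarrow> (real ^ 'n) \<times> (real ^ 'n) \<Rightarrow> real" where
  "H r z = 2 * (\<Sum>k\<in>UNIV. snd z $ k * dx k (b r) z) - dx r Q z"

text \<open>\<open>\<eta> \<omega>\<^sub>r\<close> is the bracket \<open>y\<^sup>k \<partial>\<^sub>k \<partial>\<^sub>r F\<^sup>2 - \<partial>\<^sub>r F\<^sup>2\<close> in the definition of the spray.\<close>

definition \<omega> :: "'n \<Rightarrow> (real ^ 'n) \<times> (real ^ 'n) \<Rightarrow> real" where
  "\<omega> r z = 2 * (\<Sum>k\<in>UNIV. snd z $ k * L k z) * b r z - L r z * Q z + H r z"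

lemma S_iff: "(x, y) \<in> S \<longleftrightarrow> x \<in> X \<and> y \<noteq> 0"
  by (simp add: S_def)

lemma open_S: "open S"
  unfolding S_def by (intro open_Times open_delete open_UNIV open_X)

lemma E_smooth: "smooth_on S E"
  using smooth_on_mult[OF open_S] F_smooth by (simp add: S_def E_def[abs_def] power2_eq_square)

lemma dy_E_smooth: "smooth_on S (dy r E)"
  unfolding dy_def[abs_def] by (intro smooth_on_frechet_derivative E_smooth)

lemma E_differentiable: "z \<in> S \<Longrightarrow> E differentiable (at z)"
  and dy_E_differentiable: "z \<in> S \<Longrightarrow> dy r E differentiable (at z)"
  and \<eta>_differentiable: "z \<in> S \<Longrightarrow> \<eta> differentiable (at z)"
  using smooth_on_imp_differentiable E_smooth dy_E_smooth \<eta>_smooth by (auto simp: S_def)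

lemma b_rational: "rational_in_y X (b r)"
  unfolding b_def[abs_def]
  by (intro rational_in_y_sum rational_in_y_mult rational_in_y_snd_component a_rational open_X)

lemma Q_rational: "rational_in_y X Q"
  unfolding Q_def[abs_def]
  by (intro rational_in_y_sum rational_in_y_mult rational_in_y_snd_component b_rational open_X)

lemma H_rational: "rational_in_y X (H r)"
  unfolding H_def[abs_def]
  by (intro rational_in_y_diff rational_in_y_sum rational_in_y_mult rational_in_y_const
      rational_in_y_snd_component rational_in_y_dx b_rational Q_rational open_X)

text \<open>Rationality supplies differentiability, as the denominators do not vanish for
  \<open>y \<noteq> 0\<close>.\<close>

lemma b_differentiable: "z \<in> S \<Longrightarrow> b r differentiable (at z)"
  and Q_differentiable: "z \<in> S \<Longrightarrow> Q differentiable (at z)"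
  using rational_in_y_imp_differentiable[OF b_rational] rational_in_y_imp_differentiable[OF Q_rational]
  by (cases z; simp add: S_def)+

lemma quadratic_form: "y \<bullet> (a (x, y) *v y) = Q (x, y)"
  by (simp add: inner_vec_def matrix_vector_mult_def Q_def b_def)

lemma Q_pos: "z \<in> S \<Longrightarrow> Q z > 0"
  using a_pos_definite by (cases z) (auto simp: S_iff pos_definite_def simp flip: quadratic_form)

lemma g_eq_scaleR: "z \<in> S \<Longrightarrow> fundamental_tensor F z = \<eta> z *\<^sub>R a z"
  by (cases z) (simp add: S_iff vec_eq_iff g_eq)

text \<open>Evaluating \<open>g\<close> on \<open>y\<close> gives \<open>\<eta> Q\<close>; this and
  \<open>Q\<close> are positive. Strict positivity is what the logarithm and the cancellation of
  \<open>\<eta>\<close> rest on.\<close>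

lemma \<eta>_pos:
  assumes "z \<in> S"
  shows "\<eta> z > 0"
proof -
  obtain x y where z: "z = (x, y)" "x \<in> X" "y \<noteq> 0"
    using assms by (cases z) (auto simp: S_iff)
  have "0 < y \<bullet> (fundamental_tensor F z *v y)"
    using g_pos_definite z by (simp add: pos_definite_def)
  then have "0 < \<eta> z * Q z"
    unfolding g_eq_scaleR[OF assms] by (simp add: z(1) quadratic_form flip: scaleR_matrix_vector_assoc)
  with Q_pos[OF assms] show ?thesis
    by (simp add: zero_less_mult_iff)
qed

text \<open>The fibre derivative of \<open>E\<close> is homogeneous of degree one, so Euler's
  theorem recovers it from the second fibre derivatives, which are \<open>2 \<eta> a\<close>. Thus
  \<open>\<eta>\<close> is never differentiated in \<open>y\<close>.\<close>

lemma dy_E: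
  assumes "z \<in> S"
  shows "dy r E z = 2 * (\<eta> z * b r z)"
proof -
  obtain x y where z: "z = (x, y)" "x \<in> X" "y \<noteq> 0"
    using assms by (cases z) (auto simp: S_iff)
  have "dy r E (x, t *\<^sub>R y) = t ^ 1 * dy r E (x, y)" if "t > 0" for t
    by (rule dy_homogeneous[OF open_X z(2,3) that])
      (use z that E_differentiable F_homogeneous in
        \<open>auto simp: S_iff E_def power_mult_distrib power2_eq_square\<close>)
  then have "(\<Sum>i\<in>UNIV. y $ i * dy i (dy r E) z) = real 1 * dy r E z"
    unfolding z by (intro euler_homogeneous) (use z assms dy_E_differentiable in auto)
  moreover have "dy i (dy r E) z = 2 * (\<eta> z * a z $ r $ i)" for i
  proof -
    have "1 / 2 * dy i (dy r E) z = \<eta> z * a z $ i $ r"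
      using g_eq[OF z(2,3), of i r] by (simp add: fundamental_tensor_def E_def[abs_def] z(1))
    \<comment> \<open>Euler's sum contracts the first index of \<open>a\<close>, whereas
      \<open>b\<close> contracts the second.\<close>
    moreover have "a z $ i $ r = a z $ r $ i"
      using a_symmetric[OF z(2,3)] z(1) by (metis transpose_def vec_lambda_beta)
    ultimately show ?thesis by simp
  qed
  ultimately show ?thesis
    by (simp add: b_def z(1) sum_distrib_left mult_ac)
qed

text \<open>Euler's theorem in degree two, with the fibre derivatives of \<open>E\<close> already
  known.\<close>

lemma E_eq:
  assumes "z \<in> S"
  shows "E z = \<eta> z * Q z"
proof -
  obtain x y where z: "z = (x, y)" "x \<in> X" "y \<noteq> 0"
    using assms by (cases z) (auto simp: S_iff)
  have "(\<Sum>r\<in>UNIV. y $ r * dy r E z) = real 2 * E z"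
    unfolding z
    by (rule euler_homogeneous)
      (use z assms E_differentiable F_homogeneous in \<open>auto simp: E_def power_mult_distrib\<close>)
  moreover have "(\<Sum>r\<in>UNIV. y $ r * dy r E z) = 2 * (\<eta> z * Q z)"
    unfolding dy_E[OF assms] Q_def sum_distrib_left by (rule sum.cong) (simp_all add: z(1))
  ultimately show ?thesis by simp
qed

lemma dx_\<eta>: "z \<in> S \<Longrightarrow> dx k \<eta> z = \<eta> z * L k z"
  using \<eta>_pos \<eta>_differentiable by (simp add: L_def dx_ln less_imp_neq[symmetric])

lemma dx_E:
  assumes "z \<in> S"
  shows "dx r E z = \<eta> z * (L r z * Q z + dx r Q z)"
proof -
  have "dx r E z = dx r (\<lambda>w. \<eta> w * Q w) z"
    by (rule dx_cong[OF open_S assms]) (use assms E_eq E_differentiable in auto)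
  also have "\<dots> = \<eta> z * dx r Q z + dx r \<eta> z * Q z"
    by (rule dx_mult[OF \<eta>_differentiable[OF assms] Q_differentiable[OF assms]])
  finally show ?thesis by (simp add: dx_\<eta>[OF assms] algebra_simps)
qed

text \<open>After the interchange of derivatives the fibre derivative is taken first, where it is
  \<open>2 \<eta> b\<close>; only an \<open>x\<close>-derivative then meets
  \<open>\<eta>\<close>.\<close>

lemma dy_dx_E:
  assumes "z \<in> S"
  shows "dy r (dx k E) z = 2 * \<eta> z * (L k z * b r z + dx k (b r) z)"
proof -
  have "dy r (dx k E) z = dx k (dy r E) z"
    using frechet_derivative_commute[OF open_S assms E_smooth] by (simp add: dx_def[abs_def] dy_def[abs_def])
  also have "\<dots> = dx k (\<lambda>w. \<eta> w * (2 * b r w)) z"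
    by (rule dx_cong[OF open_S assms]) (use assms dy_E dy_E_differentiable in auto)
  also have "\<dots> = \<eta> z * dx k (\<lambda>w. 2 * b r w) z + dx k \<eta> z * (2 * b r z)"
    by (rule dx_mult) (use assms \<eta>_differentiable b_differentiable in auto)
  also have "dx k (\<lambda>w. 2 * b r w) z = 2 * dx k (b r) z"
    using dx_mult[of "\<lambda>_. 2" z "b r" k] b_differentiable[OF assms] by (simp add: dx_def)
  finally show ?thesis by (simp add: dx_\<eta>[OF assms] algebra_simps)
qed

lemma spray_bracket:
  assumes "z \<in> S"
  shows "(\<Sum>k\<in>UNIV. snd z $ k * dy r (dx k E) z) - dx r E z = \<eta> z * \<omega> r z"
proof -
  have "(\<Sum>k\<in>UNIV. snd z $ k * dy r (dx k E) z)
      = 2 * \<eta> z * ((\<Sum>k\<in>UNIV. snd z $ k * L k z) * b r z + (\<Sum>k\<in>UNIV. snd z $ k * dx k (b r) z))"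
    by (simp add: dy_dx_E[OF assms] sum_distrib_left sum_distrib_right sum.distrib[symmetric] algebra_simps)
  then show ?thesis
    by (simp add: dx_E[OF assms] \<omega>_def H_def algebra_simps)
qed

text \<open>The spray is a quarter of the inverse of \<open>g\<close> applied to the bracket
  \<open>\<eta> \<omega>\<close>. Multiplying by \<open>g = \<eta> a\<close> puts
  \<open>\<eta>\<close> on both sides, and being positive it cancels.\<close>

lemma spray_linear_system:
  assumes "z \<in> S"
  shows "a z *v (\<chi> i. spray_coeff F i z) = (\<chi> r. 1/4 * \<omega> r z)"
proof -
  obtain x y where z: "z = (x, y)" "x \<in> X" "y \<noteq> 0"
    using assms by (cases z) (auto simp: S_iff)
  let ?g = "fundamental_tensor F z"
  have "(\<chi> i. spray_coeff F i z) = (1/4) *\<^sub>R (matrix_inv ?g *v (\<chi> r. \<eta> z * \<omega> r z))"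
    by (simp add: vec_eq_iff spray_coeff_def matrix_vector_mult_def flip: spray_bracket[OF assms] E_def)
  moreover have "det ?g \<noteq> 0"
    using g_pos_definite z pos_definite_det_nz by blast
  ultimately have "?g *v (\<chi> i. spray_coeff F i z) = (1/4) *\<^sub>R (\<chi> r. \<eta> z * \<omega> r z)"
    by (simp add: matrix_vector_mult_scaleR matrix_inv_solves)
  then have "\<eta> z *\<^sub>R (a z *v (\<chi> i. spray_coeff F i z)) = \<eta> z *\<^sub>R (\<chi> r. 1/4 * \<omega> r z)"
    by (simp add: g_eq_scaleR[OF assms] vec_eq_iff flip: scaleR_matrix_vector_assoc)
  then show ?thesis
    using \<eta>_pos[OF assms] by simp
qed

section \<open>The two implications in a chart\<close>

lemma sum_spray: "z \<in> S \<Longrightarrow> 4 * (\<Sum>i\<in>UNIV. a z $ r $ i * spray_coeff F i z) = \<omega> r z"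
  using spray_linear_system[of z] by (simp add: vec_eq_iff matrix_vector_mult_def mult.commute)

lemma spray_rational:
  assumes "\<And>k. rational_in_y X (L k)"
  shows "rational_in_y X (spray_coeff F i)"
proof (rule rational_in_y_cong)
  \<comment> \<open>Cramer's rule for the system with matrix \<open>a\<close>: the
    \<open>i\<close>-th column is replaced by the right-hand side.\<close>
  let ?B = "\<lambda>z. \<chi> k j. if j = i then 1/4 * \<omega> k z else a z $ k $ j"
  have \<omega>: "rational_in_y X (\<omega> r)" for r
    unfolding \<omega>_def[abs_def]
    by (intro rational_in_y_diff rational_in_y_add rational_in_y_sum rational_in_y_mult rational_in_y_const
        rational_in_y_snd_component assms b_rational Q_rational H_rational open_X)
  have "rational_in_y X (\<lambda>z. ?B z $ k $ j)" for k j
    by (cases "j = i") (auto intro!: rational_in_y_mult rational_in_y_const \<omega> a_rational open_X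
        simp del: times_divide_eq_left)
  then show "rational_in_y X (\<lambda>z. det (?B z) / det (a z))"
    by (intro rational_in_y_divide rational_in_y_det a_rational open_X)
      (auto dest!: pos_definite_det_nz[OF a_pos_definite])
  fix x y assume "x \<in> X" "y \<noteq> (0 :: real ^ 'n)"
  then have "(x, y) \<in> S" "det (a (x, y)) \<noteq> 0"
    using a_pos_definite pos_definite_det_nz by (auto simp: S_iff)
  then show "det (?B (x, y)) / det (a (x, y)) = spray_coeff F i (x, y)"
    using cramer[THEN iffD1, OF _ spray_linear_system[of "(x, y)"]]
    by (simp add: vec_eq_iff[of "vec_lambda _"] cong: if_cong)
qed

lemma L_rational:
  assumes "\<And>i. rational_in_y X (spray_coeff F i)"
  shows "rational_in_y X (L k)"
proof (rule rational_in_y_cong)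
  \<comment> \<open>By the linear system \<open>?c r\<close> equals \<open>2 s b - L Q\<close> at
    index \<open>r\<close>, with \<open>s\<close> the contraction of \<open>y\<close> and
    \<open>L\<close>; \<open>?s\<close> is the rational expression that will turn out to be
    \<open>s\<close>.\<close>
  let ?c = "\<lambda>r z. 4 * (\<Sum>i\<in>UNIV. a z $ r $ i * spray_coeff F i z) - H r z"
  let ?s = "\<lambda>z. (\<Sum>r\<in>UNIV. snd z $ r * ?c r z) / Q z"
  have Q_nz: "Q (x, y) \<noteq> 0" if "x \<in> X" "y \<noteq> 0" for x y
    using Q_pos[of "(x, y)"] that by (simp add: S_iff)
  have c: "rational_in_y X (?c r)" for r
    by (intro rational_in_y_diff rational_in_y_sum rational_in_y_mult rational_in_y_const
        a_rational assms H_rational open_X)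
  have s: "rational_in_y X ?s"
    by (intro rational_in_y_divide rational_in_y_sum rational_in_y_mult rational_in_y_snd_component
        c Q_rational open_X Q_nz)
  show "rational_in_y X (\<lambda>z. (2 * ?s z * b k z - ?c k z) / Q z)"
    by (intro rational_in_y_divide rational_in_y_diff rational_in_y_mult rational_in_y_const
        s c b_rational Q_rational open_X Q_nz)
  fix x y assume "x \<in> X" "y \<noteq> (0 :: real ^ 'n)"
  then have z: "(x, y) \<in> S" by (simp add: S_iff)
  define s where "s = (\<Sum>k\<in>UNIV. y $ k * L k (x, y))"
  have c_eq: "?c r (x, y) = 2 * s * b r (x, y) - L r (x, y) * Q (x, y)" for r
    by (simp add: sum_spray[OF z] \<omega>_def s_def)
  \<comment> \<open>Contracting with \<open>y\<close> sends \<open>b\<close> to \<open>Q\<close> and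
    \<open>L\<close> to \<open>s\<close>, so what remains is \<open>s Q\<close>, and division by
    \<open>Q\<close> gives \<open>s\<close>.\<close>
  have "(\<Sum>r\<in>UNIV. y $ r * ?c r (x, y)) = 2 * s * Q (x, y) - s * Q (x, y)"
  proof -
    have "(\<Sum>r\<in>UNIV. y $ r * (2 * s * b r (x, y))) = 2 * s * Q (x, y)"
      by (simp add: Q_def sum_distrib_left mult_ac)
    moreover have "(\<Sum>r\<in>UNIV. y $ r * (L r (x, y) * Q (x, y))) = s * Q (x, y)"
      by (simp add: s_def sum_distrib_right mult.assoc)
    ultimately show ?thesis
      unfolding c_eq by (simp add: right_diff_distrib sum_subtractf)
  qed
  then have "?s (x, y) = s"
    using Q_nz[OF \<open>x \<in> X\<close> \<open>y \<noteq> 0\<close>] by simp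
  \<comment> \<open>With \<open>s\<close> known, the formula for \<open>?c k\<close> is solved for
    \<open>L k\<close>.\<close>
  then show "(2 * ?s (x, y) * b k (x, y) - ?c k (x, y)) / Q (x, y) = L k (x, y)"
    using Q_nz[OF \<open>x \<in> X\<close> \<open>y \<noteq> 0\<close>] unfolding c_eq by simp
qed

end

theorem proposition3p12:
  fixes M :: "'m topology"
    and A :: "('m, 'n::finite) chart set"
    and F \<eta> :: "'m \<times> ('m, 'n) tvec \<Rightarrow> real"
    and a :: "('m, 'n) chart \<Rightarrow> (real ^ 'n) \<times> (real ^ 'n) \<Rightarrow> real ^ 'n ^ 'n"
    and c :: "('m, 'n) chart"
  assumes "smooth_manifold M A"
    and "AR_finsler M A F \<eta> a"
    and "c \<in> A"
  shows "(\<forall>i. rational_in_y (snd c ` fst c) (spray_coeff (local_expr A c F) i)) \<longleftrightarrow>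
         (\<forall>k. rational_in_y (snd c ` fst c) (dx k (\<lambda>z. ln (local_expr A c \<eta> z))))"
proof -
  have F: "finsler_metric M A F"
    and \<eta>: "\<forall>w\<in>slit_tangent_bundle M A. 0 \<le> \<eta> w" "smooth_on_slit A \<eta>"
    and a: "\<And>i j. rational_in_y (snd c ` fst c) (\<lambda>z. a c z $ i $ j)"
      "\<And>x y. x \<in> snd c ` fst c \<Longrightarrow> y \<noteq> 0 \<Longrightarrow> transpose (a c (x, y)) = a c (x, y)"
      "\<And>x y. x \<in> snd c ` fst c \<Longrightarrow> y \<noteq> 0 \<Longrightarrow> pos_definite (a c (x, y))"
      "\<And>x y i j. x \<in> snd c ` fst c \<Longrightarrow> y \<noteq> 0 \<Longrightarrow>
        fundamental_tensor (local_expr A c F) (x, y) $ i $ j = local_expr A c \<eta> (x, y) * a c (x, y) $ i $ j"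
    using assms(2,3) unfolding AR_finsler_def by blast+
  have "open (snd c ` fst c)"
    using atlas_is_chart[OF assms(1,3)] by (simp add: is_chart_def)
  moreover have "smooth_on (snd c ` fst c \<times> (UNIV - {0})) (local_expr A c F)"
    "\<And>x y. x \<in> snd c ` fst c \<Longrightarrow> y \<noteq> 0 \<Longrightarrow> pos_definite (fundamental_tensor (local_expr A c F) (x, y))"
    using F assms(3) unfolding finsler_metric_def smooth_on_slit_def by blast+
  moreover have "smooth_on (snd c ` fst c \<times> (UNIV - {0})) (local_expr A c \<eta>)"
    using \<eta>(2) assms(3) unfolding smooth_on_slit_def by blast
  \<comment> \<open>Homogeneity of \<open>F\<close> and nonnegativity of \<open>\<eta>\<close> are
    given on the bundle and are carried to the chart; the other assumptions are already in
    coordinates.\<close>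
  ultimately interpret local_AR_finsler "snd c ` fst c" "local_expr A c F" "local_expr A c \<eta>" "a c"
    using a finsler_local_homogeneous[OF assms(1) F assms(3)] local_expr_nonneg[OF assms(1) \<eta>(1) assms(3)]
    by unfold_locales
  show ?thesis
    using spray_rational L_rational unfolding L_def by blast
qed

end
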